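(* Let $(B,\sigma,\nu)$ be the standard uniform two-to-one endomorphism, let $Y$ be a compact metric space with a Borel probability measure $m$, and let $T:Y\to Y$ be an isometry preserving $m$ and ergodic with respect to $m$. Then the endomorphism $[T,\mathrm{Id}]$ of $(B\times Y,\nu\times m)$ given by $$[T,\mathrm{Id}](x,y)=(\sigma(x),T^{x_0}(y))$$ is one-sidedly conjugate to the standard endomorphism $(B,\sigma,\nu)$.
   Context: The standard uniform two-to-one endomorphism is $B=\{0,1\}^{\mathbb N}$ with left shift $\sigma(b)_i=b_{i+1}$ and i.i.d. measure $\nu$ giving each symbol probability $1/2$; $x_0$ is the first coordinate of $x\in B$. One-sidedly conjugate means measure-theoretically isomorphic (mod null sets) as noninvertible measure-preserving maps. *)

theory Defs
  imports "HOL-Probability.Probability"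
begin

definition measure_preserving :: "'a measure \<Rightarrow> 'b measure \<Rightarrow> ('a \<Rightarrow> 'b) \<Rightarrow> bool" where
  "measure_preserving M N f \<longleftrightarrow>
     f \<in> M \<rightarrow>\<^sub>M N \<and> (\<forall>A\<in>sets N. emeasure M (f -` A \<inter> space M) = emeasure N A)"

text \<open>Endomorphisms of probability spaces, not assumed to be invertible.\<close>

definition mp_endomorphism :: "'a measure \<Rightarrow> ('a \<Rightarrow> 'a) \<Rightarrow> bool" where
  "mp_endomorphism M S \<longleftrightarrow> prob_space M \<and> measure_preserving M M S"

definition ergodic :: "'a measure \<Rightarrow> ('a \<Rightarrow> 'a) \<Rightarrow> bool" where
  "ergodic M S \<longleftrightarrow> mp_endomorphism M S \<and>
     (\<forall>A\<in>sets M. S -` A \<inter> space M = A \<longrightarrow> emeasure M A = 0 \<or> emeasure M A = 1)"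

definition isometry_on :: "'a::metric_space set \<Rightarrow> ('a \<Rightarrow> 'a) \<Rightarrow> bool" where
  "isometry_on Y T \<longleftrightarrow> T \<in> Y \<rightarrow> Y \<and> (\<forall>x\<in>Y. \<forall>y\<in>Y. dist (T x) (T y) = dist x y)"

text \<open>Isomorphism modulo null sets: after discarding null sets from both spaces, the
  remaining sets \<open>X\<close> and \<open>Z\<close> are forward invariant and \<open>f\<close> is a bijection
  between them with inverse \<open>g\<close>, measurable and measure preserving in both directions,
  that intertwines the two maps.\<close>

definition one_sidedly_conjugate ::
    "'a measure \<Rightarrow> ('a \<Rightarrow> 'a) \<Rightarrow> 'b measure \<Rightarrow> ('b \<Rightarrow> 'b) \<Rightarrow> bool" where
  "one_sidedly_conjugate M S N R \<longleftrightarrow>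
     mp_endomorphism M S \<and> mp_endomorphism N R \<and>
     (\<exists>X\<in>sets M. \<exists>Z\<in>sets N. \<exists>f g.
        emeasure M (space M - X) = 0 \<and> emeasure N (space N - Z) = 0 \<and>
        S \<in> X \<rightarrow> X \<and> R \<in> Z \<rightarrow> Z \<and>
        measure_preserving (restrict_space M X) (restrict_space N Z) f \<and>
        measure_preserving (restrict_space N Z) (restrict_space M X) g \<and>
        (\<forall>x\<in>X. g (f x) = x) \<and> (\<forall>z\<in>Z. f (g z) = z) \<and>
        (\<forall>x\<in>X. f (S x) = R (f x)))"

text \<open>The space of \<open>coin_measure\<close> is the set of sequences with values in \<open>{0, 1}\<close>.
  Symbols are natural numbers so that \<open>x 0\<close> can serve as the exponent of an iterate.\<close>

definition coin_measure :: "(nat \<Rightarrow> nat) measure" where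
  "coin_measure = PiM UNIV (\<lambda>_. uniform_count_measure {0, 1})"

definition left_shift :: "(nat \<Rightarrow> 'a) \<Rightarrow> nat \<Rightarrow> 'a" where
  "left_shift b = (\<lambda>i. b (Suc i))"

text \<open>The map written \<open>[T, Id]\<close>.\<close>

definition skew_id :: "('y \<Rightarrow> 'y) \<Rightarrow> (nat \<Rightarrow> nat) \<times> 'y \<Rightarrow> (nat \<Rightarrow> nat) \<times> 'y" where
  "skew_id T = (\<lambda>(x, y). (left_shift x, (T ^^ x 0) y))"

end

theory Submission
  imports Defs
begin

text \<open>
  For a measurable \<open>f\<close> on \<open>B \<times> Y\<close> label a point \<open>z = (x, y)\<close> with \<open>x\<^sub>0\<close>, flipped if \<open>f (S z)\<close> holds.
  The two preimages of every point get different labels, so the sequence of labels along the orbit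
  of \<open>z\<close> is always a factor map onto the standard endomorphism. It is an isomorphism iff the labels
  determine \<open>z\<close> almost surely. Determining \<open>z\<close> up to an error \<open>e\<close>, from finitely many labels, is an
  open condition on \<open>f\<close> in measure, so it suffices to prove that it is dense and to pass to the limit
  along a rapidly converging sequence.

  Density: read time backwards, so that the labels drive a walk in \<open>B \<times> Y\<close>. Cut the walk
  into long blocks, recognisable from the labels alone. In each block run, along with the actual
  point, a canonical point that starts at a fixed place and obeys the given rule \<open>f\<close>; its path is a
  function of the labels. The actual point uses the symbol opposite to the canonical one until the
  two are close and the same symbol afterwards. As \<open>T\<close> is an isometry they then stay close until the
  block ends. By ergodicity they become close in a time that is short compared to the block, so
  the labels nearly determine the point; and since \<open>f\<close> is nearly locally constant, the new rule
  differs from \<open>f\<close> on a small set only.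
\<close>

subsection \<open>Fair labels and their itineraries\<close>

lemma prob_space_bit: "prob_space (uniform_count_measure {0, 1::nat})"
  by (rule prob_space_uniform_count_measure) auto

interpretation bits: sequence_space "uniform_count_measure {0, 1::nat}"
  by (intro sequence_space.intro product_prob_spaceI prob_space_bit)

interpretation coin: prob_space coin_measure
  unfolding coin_measure_def by (rule bits.prob_space_axioms)

lemma space_coin: "space coin_measure = {x. \<forall>i. x i \<in> {0, 1}}"
  unfolding coin_measure_def space_PiM space_uniform_count_measure by (simp add: PiE_UNIV_domain Pi_def)

lemma measurable_bit_iff:
  "f \<in> M \<rightarrow>\<^sub>M uniform_count_measure {0, 1::nat} \<longleftrightarrow> f \<in> M \<rightarrow>\<^sub>M count_space {0, 1}"
  by (intro arg_cong[where f = "\<lambda>S. f \<in> S"] measurable_cong_sets)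
    (simp_all add: sets_uniform_count_measure)

lemma measurable_coin_component [measurable]:
  "(\<lambda>x. x i) \<in> coin_measure \<rightarrow>\<^sub>M count_space UNIV"
proof -
  have "(\<lambda>x. x i) \<in> coin_measure \<rightarrow>\<^sub>M uniform_count_measure {0, 1}"
    unfolding coin_measure_def by measurable
  then show ?thesis
    unfolding measurable_bit_iff by (rule measurable_compose) simp
qed

lemma measurable_into_coin:
  assumes "\<And>i. (\<lambda>z. f z i) \<in> M \<rightarrow>\<^sub>M count_space UNIV"
    and "\<And>z i. z \<in> space M \<Longrightarrow> f z i \<in> {0, 1}"
  shows "f \<in> M \<rightarrow>\<^sub>M coin_measure"
  unfolding coin_measure_def
proof (rule measurable_PiM_single')
  fix i :: nat
  have "(\<lambda>z. f z i) \<in> M \<rightarrow>\<^sub>M count_space {0, 1}"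
    by (rule measurable_count_space_extend[rotated 2]) (use assms in auto)
  then show "(\<lambda>z. f z i) \<in> M \<rightarrow>\<^sub>M uniform_count_measure {0, 1}"
    by (simp only: measurable_bit_iff)
qed (use assms in \<open>auto simp: space_uniform_count_measure PiE_def\<close>)

text \<open>Prefixing an independent fair symbol to a coin sequence gives a coin sequence again
  (\<open>bits.PiM_iter\<close>); the two terms come from integrating over that symbol.\<close>

lemma nn_integral_coin:
  assumes [measurable]: "f \<in> borel_measurable coin_measure"
  shows "(\<integral>\<^sup>+x. f x \<partial>coin_measure) =
    (\<integral>\<^sup>+x. f (case_nat 0 x) \<partial>coin_measure) / 2 + (\<integral>\<^sup>+x. f (case_nat 1 x) \<partial>coin_measure) / 2"
proof -
  let ?U = "uniform_count_measure {0, 1::nat}"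
  have f: "f \<in> borel_measurable (PiM UNIV (\<lambda>_. ?U))"
    using assms by (simp add: coin_measure_def)
  have "(\<integral>\<^sup>+x. f x \<partial>coin_measure) =
      (\<integral>\<^sup>+x. f x \<partial>distr (?U \<Otimes>\<^sub>M coin_measure) coin_measure (\<lambda>(s, x). case_nat s x))"
    unfolding coin_measure_def bits.PiM_iter ..
  also have "\<dots> = (\<integral>\<^sup>+(s, x). f (case_nat s x) \<partial>(?U \<Otimes>\<^sub>M coin_measure))"
    using f unfolding coin_measure_def by (subst nn_integral_distr) (auto simp: split_beta')
  also have "\<dots> = (\<integral>\<^sup>+s. (\<integral>\<^sup>+x. f (case_nat s x) \<partial>coin_measure) \<partial>?U)"
    using f unfolding coin_measure_def
    by (subst bits.nn_integral_fst[symmetric]) (auto simp: split_beta')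
  also have "\<dots> = (\<Sum>s\<in>{0, 1}. (\<integral>\<^sup>+x. f (case_nat s x) \<partial>coin_measure) / 2)"
    unfolding uniform_count_measure_def
    by (subst nn_integral_point_measure_finite) (auto simp: divide_ennreal_def mult.commute)
  finally show ?thesis by simp
qed

lemma measurable_left_shift [measurable]: "left_shift \<in> coin_measure \<rightarrow>\<^sub>M coin_measure"
  by (rule measurable_into_coin) (auto simp: left_shift_def space_coin)

lemma measure_preserving_iff_distr:
  "measure_preserving M N f \<longleftrightarrow> f \<in> M \<rightarrow>\<^sub>M N \<and> distr M N f = N"
proof
  assume "measure_preserving M N f"
  then show "f \<in> M \<rightarrow>\<^sub>M N \<and> distr M N f = N"
    by (auto simp: measure_preserving_def emeasure_distr intro!: measure_eqI)
next
  assume *: "f \<in> M \<rightarrow>\<^sub>M N \<and> distr M N f = N"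
  then show "measure_preserving M N f"
    unfolding measure_preserving_def using emeasure_distr[of f M N] by auto
qed

text \<open>\<open>fair\<close> makes the label a fair coin independent of \<open>S z\<close>. This
  single condition yields both the invariance of \<open>M\<close> under \<open>S\<close> and the
  i.i.d. law of the label sequence.\<close>

locale fair_label = prob_space M for M :: "'a measure" +
  fixes S :: "'a \<Rightarrow> 'a" and h :: "'a \<Rightarrow> nat"
  assumes measurable_S [measurable]: "S \<in> M \<rightarrow>\<^sub>M M"
    and measurable_h [measurable]: "h \<in> M \<rightarrow>\<^sub>M count_space UNIV"
    and h_bit: "\<And>z. z \<in> space M \<Longrightarrow> h z \<in> {0, 1}"
    and fair: "\<And>a A. a \<in> {0, 1} \<Longrightarrow> A \<in> sets M \<Longrightarrow>
      emeasure M {z \<in> space M. h z = a \<and> S z \<in> A} = emeasure M A / 2"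
begin

lemma measurable_S_funpow [measurable]: "(S ^^ n) \<in> M \<rightarrow>\<^sub>M M"
  by (rule measurable_compose_n) simp

lemma S_funpow_space: "z \<in> space M \<Longrightarrow> (S ^^ n) z \<in> space M"
  using measurable_space[OF measurable_S_funpow] .

lemma measure_preserving_S: "measure_preserving M M S"
  unfolding measure_preserving_def
proof (intro conjI ballI)
  fix A assume [measurable]: "A \<in> sets M"
  have "S -` A \<inter> space M = {z \<in> space M. h z = 0 \<and> S z \<in> A} \<union> {z \<in> space M. h z = 1 \<and> S z \<in> A}"
    using h_bit by auto
  then have "emeasure M (S -` A \<inter> space M) = emeasure M {z \<in> space M. h z = 0 \<and> S z \<in> A} +
      emeasure M {z \<in> space M. h z = 1 \<and> S z \<in> A}"
    by (simp only:) (subst plus_emeasure, auto)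
  also have "\<dots> = emeasure M A / 2 + emeasure M A / 2"
    by (simp only: fair \<open>A \<in> sets M\<close> insertI1 insertI2)
  also have "\<dots> = emeasure M A"
    by (simp add: emeasure_eq_measure ennreal_divide_numeral flip: ennreal_plus)
  finally show "emeasure M (S -` A \<inter> space M) = emeasure M A" .
qed simp

lemma distr_S_funpow: "distr M M (S ^^ n) = M"
proof (induction n)
  case (Suc n)
  have "distr M M (S ^^ Suc n) = distr (distr M M (S ^^ n)) M S"
    by (simp only: distr_distr measurable_S measurable_S_funpow funpow.simps)
  then show ?case
    using measure_preserving_S Suc by (simp add: measure_preserving_iff_distr del: funpow.simps)
qed (simp add: id_def distr_id)

lemma prob_S_funpow: "{z \<in> space M. P z} \<in> sets M \<Longrightarrow> prob {z \<in> space M. P ((S ^^ n) z)} = prob {z \<in> space M. P z}"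
  using measure_distr[OF measurable_S_funpow, of "{z \<in> space M. P z}" n] S_funpow_space
  by (auto simp: distr_S_funpow intro!: arg_cong[where f = prob])

lemma AE_S_funpow:
  assumes "AE z in M. P z"
  shows "AE z in M. \<forall>n. P ((S ^^ n) z)"
  unfolding AE_all_countable
proof
  fix n
  show "AE z in M. P ((S ^^ n) z)"
    by (rule AE_distrD[OF measurable_S_funpow]) (use assms in \<open>simp only: distr_S_funpow\<close>)
qed

text \<open>Peels off one label at a time with \<open>fair\<close>. Each \<open>w i\<close> is a set
  of allowed symbols, so that \<open>{0, 1}\<close> leaves a coordinate free and a singleton fixes
  it.\<close>

lemma prob_word:
  assumes [measurable]: "A \<in> sets M" and w: "\<And>i. w i \<subseteq> {0, 1}"
  shows "emeasure M {z \<in> space M. (\<forall>i<n. h ((S ^^ i) z) \<in> w i) \<and> (S ^^ n) z \<in> A} =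
    (\<Prod>i<n. card (w i) / 2) * emeasure M A"
  using w
proof (induction n arbitrary: w)
  case 0
  then show ?case
    using sets.sets_into_space[of A M] by (auto intro!: arg_cong[where f = "emeasure M"])
next
  case (Suc n)
  let ?B = "{z \<in> space M. (\<forall>i<n. h ((S ^^ i) z) \<in> w (Suc i)) \<and> (S ^^ n) z \<in> A}"
  let ?C = "\<lambda>a. {z \<in> space M. h z = a \<and> S z \<in> ?B}"
  have fin: "finite (w 0)"
    using Suc.prems finite_subset by blast
  have "{z \<in> space M. (\<forall>i<Suc n. h ((S ^^ i) z) \<in> w i) \<and> (S ^^ Suc n) z \<in> A} = (\<Union>a\<in>w 0. ?C a)"
    using measurable_space[OF measurable_S]
    by (auto simp: All_less_Suc2 funpow_swap1)
  also have "emeasure M \<dots> = (\<Sum>a\<in>w 0. emeasure M (?C a))"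
    by (rule sum_emeasure[symmetric]) (use fin in \<open>auto simp: disjoint_family_on_def\<close>)
  also have "\<dots> = (\<Sum>a\<in>w 0. emeasure M ?B / 2)"
    by (intro sum.cong refl fair) (use Suc.prems in \<open>auto\<close>)
  also have "\<dots> = (card (w 0) / 2) * emeasure M ?B"
    by (simp add: divide_ennreal_def mult_ac ennreal_mult' ennreal_divide_numeral[symmetric] ennreal_of_nat_eq_real_of_nat)
  also have "emeasure M ?B = (\<Prod>i<n. card (w (Suc i)) / 2) * emeasure M A"
    by (rule Suc.IH) (use Suc.prems in auto)
  also have "ennreal (card (w 0) / 2) * (ennreal (\<Prod>i<n. card (w (Suc i)) / 2) * emeasure M A) =
      ennreal (card (w 0) / 2 * (\<Prod>i<n. card (w (Suc i)) / 2)) * emeasure M A"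
    by (subst ennreal_mult) (auto intro!: prod_nonneg simp: mult.assoc)
  finally show ?case
    by (simp only: prod.lessThan_Suc_shift)
qed

definition itinerary :: "'a \<Rightarrow> nat \<Rightarrow> nat" where
  "itinerary z i = h ((S ^^ i) z)"

lemma measurable_itinerary [measurable]: "itinerary \<in> M \<rightarrow>\<^sub>M coin_measure"
  by (rule measurable_into_coin)
    (use h_bit S_funpow_space in \<open>auto simp: itinerary_def\<close>)

lemma itinerary_S: "itinerary (S z) = left_shift (itinerary z)"
  by (simp add: itinerary_def left_shift_def funpow_swap1 fun_eq_iff)

text \<open>Cylinders determine the product measure, and the preimage of a cylinder is a word event
  as in \<open>prob_word\<close>.\<close>

lemma measure_preserving_itinerary: "measure_preserving M coin_measure itinerary"
  unfolding measure_preserving_iff_distr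
proof
  show "distr M coin_measure itinerary = coin_measure"
    unfolding coin_measure_def
  proof (rule bits.PiM_eq)
    fix J :: "nat set" and F
    assume J: "finite J" and F: "\<And>j. j \<in> J \<Longrightarrow> F j \<in> sets (uniform_count_measure {0, 1::nat})"
    let ?U = "uniform_count_measure {0, 1::nat}"
    obtain n where n: "j < n" if "j \<in> J" for j
      using J unfolding finite_nat_iff_bounded by auto
    define w where "w i = (if i \<in> J then F i else {0, 1})" for i
    have w: "w i \<subseteq> {0, 1}" for i
      using F[of i] unfolding sets_uniform_count_measure w_def by auto
    have U: "emeasure ?U (F i) = ennreal (card (F i) / 2)" if "i \<in> J" for i
      using F[OF that] unfolding sets_uniform_count_measure by (subst emeasure_uniform_count_measure) auto
    have "itinerary -` prod_emb UNIV (\<lambda>_. ?U) J (Pi\<^sub>E J F) \<inter> space M =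
        {z \<in> space M. (\<forall>i<n. h ((S ^^ i) z) \<in> w i) \<and> (S ^^ n) z \<in> space M}"
      using n h_bit S_funpow_space
      by (auto simp: prod_emb_def w_def itinerary_def space_uniform_count_measure PiE_iff)
    then have "emeasure (distr M coin_measure itinerary) (prod_emb UNIV (\<lambda>_. ?U) J (Pi\<^sub>E J F)) =
        (\<Prod>i<n. ennreal (card (w i) / 2))"
      using J F measurable_itinerary by (subst emeasure_distr)
        (simp_all add: prob_word[OF sets.top w] emeasure_space_1 prod_ennreal sets_PiM_I coin_measure_def)
    also have "\<dots> = (\<Prod>i\<in>J. ennreal (card (w i) / 2))"
      by (rule prod.mono_neutral_right) (use n in \<open>auto simp: w_def\<close>)
    also have "\<dots> = (\<Prod>i\<in>J. emeasure ?U (F i))"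
      by (intro prod.cong refl) (simp only: w_def U if_True)
    finally show "emeasure (distr M (Pi\<^sub>M UNIV (\<lambda>_. ?U)) itinerary) (prod_emb UNIV (\<lambda>_. ?U) J (Pi\<^sub>E J F)) =
        (\<Prod>i\<in>J. emeasure ?U (F i))"
      by (simp add: coin_measure_def)
  qed (simp_all add: coin_measure_def)
qed simp

lemma sets_no_run:
  "{z \<in> space M. \<not> (\<exists>i. \<forall>j<N. h ((S ^^ (i + j)) z) = c)} \<in> sets M"
  by measurable

text \<open>For a point of the exceptional set \<open>E\<close>, the \<open>N\<close>-th iterate is
  again in \<open>E\<close>, but the first \<open>N\<close> labels are not all \<open>c\<close>. So
  \<open>E\<close> lies in \<open>F - G\<close>, where \<open>prob F = prob E\<close> and
  \<open>prob G = (1 / 2) ^ N * prob E\<close>, which forces \<open>prob E = 0\<close>.\<close>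

lemma AE_run:
  assumes "c \<in> {0, 1}"
  shows "AE z in M. \<exists>i. \<forall>j<N. h ((S ^^ (i + j)) z) = c"
proof -
  define E where "E = {z \<in> space M. \<not> (\<exists>i. \<forall>j<N. h ((S ^^ (i + j)) z) = c)}"
  have E [measurable]: "E \<in> sets M" unfolding E_def by (rule sets_no_run)
  define G where "G = {z \<in> space M. (\<forall>i<N. h ((S ^^ i) z) \<in> {c}) \<and> (S ^^ N) z \<in> E}"
  have G [measurable]: "G \<in> sets M" unfolding G_def singleton_iff by measurable
  define F where "F = {z \<in> space M. (S ^^ N) z \<in> E}"
  have F [measurable]: "F \<in> sets M" unfolding F_def by measurable
  have "emeasure M G = ennreal ((1 / 2) ^ N) * emeasure M E"
    unfolding G_def using assms by (subst prob_word) auto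
  then have prob_G: "prob G = (1 / 2) ^ N * prob E"
    by (simp add: measure_def enn2real_mult)
  have "E \<subseteq> F - G"
  proof
    fix z assume z: "z \<in> E"
    then have no_run: "\<not> (\<forall>j<N. h ((S ^^ (k + j)) z) = c)" for k
      unfolding E_def by simp
    have shift: "(S ^^ (i + j)) ((S ^^ N) z) = (S ^^ ((i + N) + j)) z" for i j
    proof -
      have "(i + N) + j = (i + j) + N" by simp
      then show ?thesis by (simp only: funpow_add o_apply)
    qed
    have "(S ^^ N) z \<in> E"
      using z no_run unfolding E_def mem_Collect_eq shift by (simp add: S_funpow_space)
    moreover have "z \<notin> G"
      using no_run[of 0] unfolding G_def by simp
    ultimately show "z \<in> F - G"
      using z unfolding F_def by (simp add: E_def)
  qed
  then have "prob E \<le> prob (F - G)"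
    by (rule finite_measure_mono) measurable
  also have "\<dots> = prob F - prob G"
    by (rule finite_measure_Diff) (auto simp: F_def G_def)
  also have "prob F = prob E"
    unfolding F_def by (subst prob_S_funpow) (use sets.sets_into_space[OF E] in \<open>auto intro!: arg_cong[where f = prob]\<close>)
  finally have "(1 / 2) ^ N * prob E \<le> 0"
    unfolding prob_G by simp
  moreover have "0 < (1 / 2 :: real) ^ N" by simp
  ultimately have "prob E = 0"
    by (metis measure_nonneg mult_pos_pos not_less order_le_less)
  then have "emeasure M E = 0"
    by (simp add: emeasure_eq_measure)
  then show ?thesis
    by (intro AE_I[of _ _ E]) (auto simp: E_def)
qed

lemma sets_no_run_within:
  "{z \<in> space M. \<not> (\<exists>i. i + N \<le> K \<and> (\<forall>j<N. h ((S ^^ (i + j)) z) = c))} \<in> sets M"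
  by measurable

text \<open>Continuity from above turns the almost sure run of \<open>AE_run\<close> into a likely
  run in a bounded window.\<close>

lemma run_likely:
  assumes "c \<in> {0, 1}" "0 < e"
  shows "\<exists>K. prob {z \<in> space M. \<not> (\<exists>i. i + N \<le> K \<and> (\<forall>j<N. h ((S ^^ (i + j)) z) = c))} < e"
proof -
  let ?E = "\<lambda>K. {z \<in> space M. \<not> (\<exists>i. i + N \<le> K \<and> (\<forall>j<N. h ((S ^^ (i + j)) z) = c))}"
  have "(\<lambda>K. prob (?E K)) \<longlonglongrightarrow> prob (\<Inter>K. ?E K)"
      proof (rule finite_Lim_measure_decseq)
    show "range ?E \<subseteq> events"
      using sets_no_run_within by blast
    show "decseq ?E" unfolding decseq_def by (auto intro: order_trans)
  qed
  also have "prob (\<Inter>K. ?E K) = 0"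
  proof -
    have "(\<Inter>K. ?E K) = {z \<in> space M. \<not> (\<exists>i. \<forall>j<N. h ((S ^^ (i + j)) z) = c)}"
      by auto
    also have "emeasure M \<dots> = 0"
      by (rule AE_iff_measurable[THEN iffD1, OF _ refl AE_run[OF assms(1)]]) measurable
    finally show ?thesis by (simp add: measure_def)
  qed
  finally have "eventually (\<lambda>K. prob (?E K) < e) sequentially"
    using assms(2) by (rule order_tendstoD)
  then show ?thesis
    using eventually_sequentially by auto
qed

end

lemma left_shift_case_nat [simp]: "left_shift (case_nat b x) = x"
  by (simp add: left_shift_def)

lemma case_nat_in_space_coin: "b \<in> {0, 1} \<Longrightarrow> x \<in> space coin_measure \<Longrightarrow> case_nat b x \<in> space coin_measure"
  by (simp add: space_coin split: nat.split)

lemma fair_label_coin: "fair_label coin_measure left_shift (\<lambda>x. x 0)"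
proof
  fix a :: nat and A assume a: "a \<in> {0, 1}" and A [measurable]: "A \<in> sets coin_measure"
  define E where "E = {x \<in> space coin_measure. x 0 = a \<and> left_shift x \<in> A}"
  have E [measurable]: "E \<in> sets coin_measure"
    unfolding E_def by measurable
  have slice: "(\<integral>\<^sup>+x. indicator E (case_nat b x) \<partial>coin_measure) = (if b = a then emeasure coin_measure A else 0)"
    if b: "b \<in> {0, 1}" for b
  proof -
    have "(\<integral>\<^sup>+x. indicator E (case_nat b x) \<partial>coin_measure) =
        (\<integral>\<^sup>+x. (if b = a then indicator A x else 0) \<partial>coin_measure)"
      using case_nat_in_space_coin[OF b]
      by (intro nn_integral_cong) (simp add: E_def indicator_def)
    then show ?thesis by simp
  qed
  have "emeasure coin_measure E = (\<integral>\<^sup>+x. indicator E x \<partial>coin_measure)"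
    by simp
  also have "\<dots> = (if 0 = a then emeasure coin_measure A else 0) / 2 + (if 1 = a then emeasure coin_measure A else 0) / 2"
    by (subst nn_integral_coin, measurable) (simp only: slice insertI1 insertI2)
  also have "\<dots> = emeasure coin_measure A / 2"
    using a by auto
  finally show "emeasure coin_measure {x \<in> space coin_measure. x 0 = a \<and> left_shift x \<in> A} =
      emeasure coin_measure A / 2"
    by (simp only: E_def)
qed (auto simp: space_coin)

interpretation shift: fair_label coin_measure left_shift "\<lambda>x. x 0"
  by (rule fair_label_coin)

lemma mp_endomorphism_left_shift: "mp_endomorphism coin_measure left_shift"
  unfolding mp_endomorphism_def using coin.prob_space_axioms shift.measure_preserving_S by simp

lemma measure_preserving_funpow:
  assumes "measure_preserving M M T"
  shows "measure_preserving M M (T ^^ n)"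
proof (induction n)
  case 0
  show ?case by (simp add: measure_preserving_iff_distr id_def distr_id)
next
  case (Suc n)
  then have *: "T \<in> M \<rightarrow>\<^sub>M M" "T ^^ n \<in> M \<rightarrow>\<^sub>M M" "distr M M T = M" "distr M M (T ^^ n) = M"
    using assms by (auto simp: measure_preserving_iff_distr)
  have "distr M M (T \<circ> T ^^ n) = distr (distr M M (T ^^ n)) M T"
    using * by (intro distr_distr[symmetric])
  also have "\<dots> = M" using * by simp
  finally show ?case
    using * by (simp only: measure_preserving_iff_distr measurable_comp funpow.simps simp_thms)
qed

subsection \<open>The skew product\<close>

locale ergodic_isometry =
  fixes Y :: "'y::metric_space set" and m :: "'y measure" and T :: "'y \<Rightarrow> 'y"
  assumes compact_Y: "compact Y"
    and sets_m: "sets m = sets (restrict_space borel Y)"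
    and isometry_T: "isometry_on Y T"
    and ergodic_T: "ergodic m T"
begin

sublocale m: prob_space m
  using ergodic_T by (simp add: ergodic_def mp_endomorphism_def)

lemma space_m [simp]: "space m = Y"
  using sets_eq_imp_space_eq[OF sets_m] by (simp add: space_restrict_space)

lemma measure_preserving_T: "measure_preserving m m T"
  using ergodic_T by (simp add: ergodic_def mp_endomorphism_def)

lemma measurable_T [measurable]: "T \<in> m \<rightarrow>\<^sub>M m"
  using measure_preserving_T by (simp add: measure_preserving_def)

lemma measurable_T_funpow [measurable]: "(T ^^ n) \<in> m \<rightarrow>\<^sub>M m"
  by (rule measurable_compose_n) simp

lemma T_in_Y: "y \<in> Y \<Longrightarrow> T y \<in> Y"
  using isometry_T by (auto simp: isometry_on_def)

lemma T_funpow_in_Y: "y \<in> Y \<Longrightarrow> (T ^^ n) y \<in> Y"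
  by (induction n) (auto simp: T_in_Y)

lemma dist_T_funpow: "x \<in> Y \<Longrightarrow> y \<in> Y \<Longrightarrow> dist ((T ^^ n) x) ((T ^^ n) y) = dist x y"
  using isometry_T by (induction n) (auto simp: isometry_on_def T_funpow_in_Y)

lemma borel_measurable_id_m: "(\<lambda>y. y) \<in> borel_measurable m"
  unfolding measurable_cong_sets[OF sets_m refl] by (rule measurable_restrict_space1) simp

lemma borel_measurable_dist_m [measurable]: "(\<lambda>y. dist y q) \<in> borel_measurable m"
  by (intro measurable_compose[OF borel_measurable_id_m] borel_measurable_continuous_onI continuous_intros)

lemma measurable_into_m:
  assumes "f \<in> borel_measurable M" "\<And>z. z \<in> space M \<Longrightarrow> f z \<in> Y"
  shows "f \<in> M \<rightarrow>\<^sub>M m"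
  unfolding measurable_cong_sets[OF refl sets_m]
  by (rule measurable_restrict_space2) (use assms in auto)

abbreviation \<mu> :: "((nat \<Rightarrow> nat) \<times> 'y) measure" where
  "\<mu> \<equiv> coin_measure \<Otimes>\<^sub>M m"

abbreviation S :: "(nat \<Rightarrow> nat) \<times> 'y \<Rightarrow> (nat \<Rightarrow> nat) \<times> 'y" where
  "S \<equiv> skew_id T"

sublocale coin_m: pair_prob_space coin_measure m ..

lemma space_\<mu>: "space \<mu> = space coin_measure \<times> Y"
  by (simp add: space_pair_measure)

lemma bit_\<mu>: "z \<in> space \<mu> \<Longrightarrow> fst z i \<in> {0, 1}"
  by (auto simp: space_\<mu> space_coin)

lemma measurable_symbol [measurable]: "(\<lambda>z. fst z i) \<in> \<mu> \<rightarrow>\<^sub>M count_space UNIV"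
  by (rule measurable_compose[OF measurable_fst measurable_coin_component])

lemma fst_S: "fst (S z) = left_shift (fst z)"
  by (simp add: skew_id_def split_beta)

lemma snd_S: "snd (S z) = (T ^^ fst z 0) (snd z)"
  by (simp add: skew_id_def split_beta)

lemma fst_S_funpow: "fst ((S ^^ n) z) i = fst z (n + i)"
  by (induction n arbitrary: z) (auto simp: fst_S left_shift_def funpow_swap1)

lemma measurable_S [measurable]: "S \<in> \<mu> \<rightarrow>\<^sub>M \<mu>"
proof -
  have "(\<lambda>z. (T ^^ fst z 0) (snd z)) \<in> \<mu> \<rightarrow>\<^sub>M m"
    by (rule measurable_compose_countable[where g = "\<lambda>z. fst z 0"]) measurable
  moreover have "(\<lambda>z. left_shift (fst z)) \<in> \<mu> \<rightarrow>\<^sub>M coin_measure"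
    by measurable
  ultimately have "(\<lambda>z. (left_shift (fst z), (T ^^ fst z 0) (snd z))) \<in> \<mu> \<rightarrow>\<^sub>M \<mu>"
    by (intro measurable_Pair)
  then show ?thesis
    by (simp only: skew_id_def split_beta')
qed

definition flip_label :: "((nat \<Rightarrow> nat) \<times> 'y \<Rightarrow> bool) \<Rightarrow> (nat \<Rightarrow> nat) \<times> 'y \<Rightarrow> nat" where
  "flip_label f z = (if f (S z) then 1 - fst z 0 else fst z 0)"

text \<open>Fix the first symbol \<open>b\<close> and integrate over the rest: only
  \<open>b = a\<close> contributes, and there each fibre is a preimage under \<open>T ^^ a\<close>,
  which has the same \<open>m\<close>-measure.\<close>

lemma fair_symbol:
  assumes a: "a \<in> {0, 1}" and A [measurable]: "A \<in> sets \<mu>"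
  shows "emeasure \<mu> {z \<in> space \<mu>. fst z 0 = a \<and> S z \<in> A} = emeasure \<mu> A / 2"
proof -
  define E where "E = {z \<in> space \<mu>. fst z 0 = a \<and> S z \<in> A}"
  have E [measurable]: "E \<in> sets \<mu>"
    unfolding E_def by measurable
  have slice: "emeasure m (Pair (case_nat b x) -` E) = (if b = a then emeasure m (Pair x -` A) else 0)"
    if b: "b \<in> {0, 1}" and x: "x \<in> space coin_measure" for b x
  proof -
    have "Pair x -` A \<in> sets m"
      by (rule sets_Pair1[OF A])
    then have "emeasure m ((T ^^ a) -` (Pair x -` A) \<inter> space m) = emeasure m (Pair x -` A)"
      using measure_preserving_funpow[OF measure_preserving_T, of a]
      by (simp add: measure_preserving_def)
    moreover have "Pair (case_nat b x) -` E = (if b = a then (T ^^ a) -` (Pair x -` A) \<inter> space m else {})"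
      using case_nat_in_space_coin[OF b x] by (auto simp: E_def space_\<mu> skew_id_def)
    ultimately show ?thesis by simp
  qed
  have "emeasure \<mu> E = (\<integral>\<^sup>+x. emeasure m (Pair x -` E) \<partial>coin_measure)"
    by (rule m.emeasure_pair_measure_alt[OF E])
  also have "\<dots> = (\<integral>\<^sup>+x. emeasure m (Pair (case_nat 0 x) -` E) \<partial>coin_measure) / 2 +
      (\<integral>\<^sup>+x. emeasure m (Pair (case_nat 1 x) -` E) \<partial>coin_measure) / 2"
    by (rule nn_integral_coin[OF m.measurable_emeasure_Pair[OF E]])
  also have "\<dots> = (\<integral>\<^sup>+x. (if 0 = a then emeasure m (Pair x -` A) else 0) \<partial>coin_measure) / 2 +
      (\<integral>\<^sup>+x. (if 1 = a then emeasure m (Pair x -` A) else 0) \<partial>coin_measure) / 2"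
    by (intro arg_cong2[where f = "(+)"] arg_cong2[where f = "(/)"] nn_integral_cong refl slice) auto
  also have "\<dots> = (\<integral>\<^sup>+x. emeasure m (Pair x -` A) \<partial>coin_measure) / 2"
    using a by auto
  also have "(\<integral>\<^sup>+x. emeasure m (Pair x -` A) \<partial>coin_measure) = emeasure \<mu> A"
    by (rule m.emeasure_pair_measure_alt[OF A, symmetric])
  finally show ?thesis
    by (simp only: E_def)
qed

lemma measurable_flip_label:
  assumes [measurable]: "Measurable.pred \<mu> f"
  shows "flip_label f \<in> \<mu> \<rightarrow>\<^sub>M count_space UNIV"
proof -
  have [measurable]: "Measurable.pred \<mu> (\<lambda>z. f (S z))"
    by (rule measurable_compose[OF measurable_S assms])
  have [measurable]: "(\<lambda>z. 1 - fst z 0) \<in> \<mu> \<rightarrow>\<^sub>M count_space UNIV"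
    by (rule measurable_compose[OF measurable_symbol]) simp
  have "(\<lambda>z. if f (S z) then 1 - fst z 0 else fst z 0) \<in> \<mu> \<rightarrow>\<^sub>M count_space UNIV"
    by (rule measurable_If) measurable
  then show ?thesis
    by (simp add: flip_label_def[abs_def])
qed

lemma flip_label_bit: "z \<in> space \<mu> \<Longrightarrow> flip_label f z \<in> {0, 1}"
  using bit_\<mu>[of z 0] by (auto simp: flip_label_def)

text \<open>The flip is decided at \<open>S z\<close>. After splitting \<open>A\<close> according to
  \<open>f\<close>, label \<open>a\<close> therefore means one fixed symbol on each part, and
  \<open>fair_symbol\<close> applies.\<close>

lemma fair_label_flip_label:
  assumes f [measurable]: "Measurable.pred \<mu> f"
  shows "fair_label \<mu> S (flip_label f)"
proof
  fix a :: nat and A assume a: "a \<in> {0, 1}" and A [measurable]: "A \<in> sets \<mu>"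
  let ?P = "{z \<in> space \<mu>. f z} \<inter> A" and ?N = "{z \<in> space \<mu>. \<not> f z} \<inter> A"
  have [measurable]: "?P \<in> sets \<mu>" "?N \<in> sets \<mu>" by measurable
  have "{z \<in> space \<mu>. flip_label f z = a \<and> S z \<in> A} =
      {z \<in> space \<mu>. fst z 0 = 1 - a \<and> S z \<in> ?P} \<union> {z \<in> space \<mu>. fst z 0 = a \<and> S z \<in> ?N}"
    using a bit_\<mu>[of _ 0] measurable_space[OF measurable_S] unfolding flip_label_def by fastforce
  then have "emeasure \<mu> {z \<in> space \<mu>. flip_label f z = a \<and> S z \<in> A} =
      emeasure \<mu> {z \<in> space \<mu>. fst z 0 = 1 - a \<and> S z \<in> ?P} + emeasure \<mu> {z \<in> space \<mu>. fst z 0 = a \<and> S z \<in> ?N}"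
    by (simp only:) (subst plus_emeasure, auto)
  also have "\<dots> = emeasure \<mu> ?P / 2 + emeasure \<mu> ?N / 2"
    by (intro arg_cong2[where f = "(+)"] fair_symbol) (use a in auto)
  also have "\<dots> = (emeasure \<mu> ?P + emeasure \<mu> ?N) / 2"
    by (simp add: divide_ennreal_def distrib_right)
  also have "emeasure \<mu> ?P + emeasure \<mu> ?N = emeasure \<mu> A"
    using sets.sets_into_space[OF A] by (subst plus_emeasure) (auto intro!: arg_cong[where f = "emeasure \<mu>"])
  finally show "emeasure \<mu> {z \<in> space \<mu>. flip_label f z = a \<and> S z \<in> A} = emeasure \<mu> A / 2" .
qed (use flip_label_bit in \<open>auto simp: measurable_flip_label\<close>)

text \<open>The symbols themselves are the labels of the constantly false rule.\<close>

sublocale symbols: fair_label \<mu> S "\<lambda>z. fst z 0"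
proof -
  have "flip_label (\<lambda>_. False) = (\<lambda>z. fst z 0)"
    by (simp add: flip_label_def fun_eq_iff)
  then show "fair_label \<mu> S (\<lambda>z. fst z 0)"
    using fair_label_flip_label[of "\<lambda>_. False"] by simp
qed

subsection \<open>Uniform hitting times and locally constant approximation\<close>

text \<open>The set \<open>L\<close> of points with infinitely many visits is strictly invariant, so
  it has measure 0 or 1. It is the decreasing limit of sets \<open>U n\<close> containing the
  preimage of \<open>A\<close> under \<open>T ^^ n\<close>, so its measure is at least that of
  \<open>A\<close>.\<close>

lemma AE_hits_infinitely_often:
  assumes A [measurable]: "A \<in> sets m" and pos: "0 < measure m A"
  shows "AE p in m. \<forall>n. \<exists>j\<ge>n. (T ^^ j) p \<in> A"
proof -
  define U where "U n = {p \<in> space m. \<exists>j\<ge>n. (T ^^ j) p \<in> A}" for n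
  have U [measurable]: "U n \<in> sets m" for n
    unfolding U_def by measurable
  define L where "L = (\<Inter>n. U n)"
  have L [measurable]: "L \<in> sets m"
    unfolding L_def by measurable
  have U_Suc: "T y \<in> U n \<longleftrightarrow> y \<in> U (Suc n)" if "y \<in> Y" for y n
  proof -
    have "(\<exists>j\<ge>n. (T ^^ j) (T y) \<in> A) \<longleftrightarrow> (\<exists>j\<ge>n. (T ^^ Suc j) y \<in> A)"
      by (simp add: funpow_swap1)
    also have "\<dots> \<longleftrightarrow> (\<exists>j\<ge>Suc n. (T ^^ j) y \<in> A)"
      by (metis Suc_le_D Suc_le_mono)
    finally show ?thesis
      using that by (simp add: U_def T_in_Y)
  qed
  have "U (Suc n) \<subseteq> U n" for n
    by (auto simp: U_def intro: Suc_leD)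
  then have dec: "decseq U"
    by (rule decseq_SucI)
  have "T -` L \<inter> space m = L"
  proof (intro set_eqI iffI)
    fix y assume "y \<in> T -` L \<inter> space m"
    then have "y \<in> U (Suc n)" for n
      using U_Suc[of y n] by (auto simp: L_def)
    then show "y \<in> L"
      using \<open>\<And>n. U (Suc n) \<subseteq> U n\<close> by (auto simp: L_def)
  next
    fix y assume "y \<in> L"
    then have "y \<in> Y" "y \<in> U (Suc n)" for n
      by (auto simp: L_def U_def)
    then show "y \<in> T -` L \<inter> space m"
      using U_Suc[of y] by (auto simp: L_def)
  qed
  then have "emeasure m L = 0 \<or> emeasure m L = 1"
    using ergodic_T L by (simp add: ergodic_def)
  moreover have "measure m A \<le> measure m L"
  proof (rule LIMSEQ_le_const)
    show "(\<lambda>n. measure m (U n)) \<longlonglongrightarrow> measure m L"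
      unfolding L_def by (rule m.finite_Lim_measure_decseq) (use dec in auto)
    have "measure m A \<le> measure m (U n)" for n
    proof -
      have "emeasure m A = emeasure m ((T ^^ n) -` A \<inter> space m)"
        using measure_preserving_funpow[OF measure_preserving_T, of n] A
        by (simp add: measure_preserving_def)
      then have "measure m A = measure m ((T ^^ n) -` A \<inter> space m)"
        by (simp add: measure_def)
      also have "\<dots> \<le> measure m (U n)"
        by (rule m.finite_measure_mono[OF _ U]) (auto simp: U_def)
      finally show ?thesis .
    qed
    then show "\<exists>N. \<forall>n\<ge>N. measure m A \<le> measure m (U n)"
      by blast
  qed
  ultimately have "measure m L = 1"
    using pos by (auto simp: measure_def)
  then have "AE p in m. p \<in> L"
    using m.prob_eq_1[OF L] by simp
  then show ?thesis
    by (rule AE_mp) (auto simp: L_def U_def)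
qed

text \<open>The bound does not depend on \<open>s\<close> because \<open>T\<close> is an isometry and the orbit of \<open>p\<close> is
  totally bounded.\<close>

lemma uniform_hitting:
  assumes "0 < e"
  shows "\<exists>p\<in>Y. \<exists>R. AE y in m. \<forall>s. \<exists>j\<le>R. dist y ((T ^^ (s + j)) p) < e"
proof -
  obtain Q where Q: "finite Q" "Y \<subseteq> (\<Union>q\<in>Q. ball q (e / 4))"
    using compact_Y assms unfolding compact_eq_totally_bounded
    by (metis divide_pos_pos zero_less_numeral)
  define B where "B q = {y \<in> space m. dist y q < e / 4}" for q
  have B [measurable]: "B q \<in> sets m" for q
    unfolding B_def by measurable
  \<comment> \<open>Almost no \<open>y\<close> lies in a ball whose centre is outside
    \<open>P\<close>, while the orbit of almost every \<open>p\<close> keeps returning to every ball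
    with centre in \<open>P\<close>.\<close>
  define P where "P = {q \<in> Q. 0 < measure m (B q)}"
  have P: "finite P" "P \<subseteq> Q"
    using Q(1) by (auto simp: P_def)
  have "AE p in m. \<forall>q\<in>P. \<forall>n. \<exists>j\<ge>n. (T ^^ j) p \<in> B q"
    by (rule AE_finite_allI[OF P(1)]) (auto simp: P_def intro!: AE_hits_infinitely_often)
  then have "AE p in m. p \<in> Y \<and> (\<forall>q\<in>P. \<forall>n. \<exists>j\<ge>n. (T ^^ j) p \<in> B q)"
    using AE_space[of m] by eventually_elim simp
  then have "\<exists>p. p \<in> Y \<and> (\<forall>q\<in>P. \<forall>n. \<exists>j\<ge>n. (T ^^ j) p \<in> B q)"
    by (rule eventually_happens'[OF m.ae_filter_bot])
  then obtain p where p: "p \<in> Y" and hit: "\<And>q n. q \<in> P \<Longrightarrow> \<exists>j\<ge>n. (T ^^ j) p \<in> B q"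
    by blast
  define s0 where "s0 q = (SOME s. dist ((T ^^ s) p) q < e / 4)" for q
  have "\<exists>J. \<forall>q r. r \<in> P \<longrightarrow> (T ^^ (s0 q + J q r)) p \<in> B r"
  proof (intro choice allI)
    fix q r
    show "\<exists>j. r \<in> P \<longrightarrow> (T ^^ (s0 q + j)) p \<in> B r"
      using hit[of r "s0 q"] by (metis le_add_diff_inverse)
  qed
  then obtain J where J: "\<And>q r. r \<in> P \<Longrightarrow> (T ^^ (s0 q + J q r)) p \<in> B r"
    by blast
  \<comment> \<open>Only finitely many waiting times occur; their sum is a common bound.\<close>
  define R where "R = (\<Sum>q\<in>Q. \<Sum>r\<in>Q. J q r)"
  have R: "J q r \<le> R" if "q \<in> Q" "r \<in> Q" for q r
  proof -
    have "J q r \<le> (\<Sum>r\<in>Q. J q r)"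
      by (rule member_le_sum) (use that Q in auto)
    also have "\<dots> \<le> R"
      unfolding R_def by (rule member_le_sum) (use that Q in auto)
    finally show ?thesis .
  qed
  have "AE y in m. \<forall>q\<in>Q - P. y \<notin> B q"
  proof (rule AE_finite_allI)
    fix q assume "q \<in> Q - P"
    then have "measure m (B q) = 0"
      using measure_nonneg[of m "B q"] by (auto simp: P_def)
    then have "B q \<in> null_sets m"
      by (simp add: null_sets_def m.emeasure_eq_measure)
    then show "AE y in m. y \<notin> B q"
      by (rule AE_not_in)
  qed (use Q in simp)
  then have "AE y in m. \<forall>s. \<exists>j\<le>R. dist y ((T ^^ (s + j)) p) < e"
    using AE_space[of m]
  proof eventually_elim
    fix y assume y: "\<forall>q\<in>Q - P. y \<notin> B q" "y \<in> space m"
    then obtain r where r: "r \<in> Q" "dist y r < e / 4"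
      using Q(2) by (auto simp: dist_commute)
    then have "r \<in> P"
      using y by (auto simp: B_def)
    show "\<forall>s. \<exists>j\<le>R. dist y ((T ^^ (s + j)) p) < e"
    proof
      fix s
      obtain q where q: "q \<in> Q" "dist ((T ^^ s) p) q < e / 4"
        using Q(2) T_funpow_in_Y[OF p, of s] by (auto simp: dist_commute)
      then have s0: "dist ((T ^^ s0 q) p) q < e / 4"
        unfolding s0_def by (rule_tac someI)
      let ?j = "J q r"
      \<comment> \<open>At times \<open>s\<close> and \<open>s0 q\<close> the orbit is near the same
        centre. The isometry keeps the two positions close after an equal delay, so the delay found
        for \<open>s0 q\<close> serves \<open>s\<close> as well.\<close>
      have "dist ((T ^^ (s0 q + ?j)) p) ((T ^^ (s + ?j)) p) = dist ((T ^^ s0 q) p) ((T ^^ s) p)"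
        using dist_T_funpow[of "(T ^^ s0 q) p" "(T ^^ s) p" ?j] p
        by (simp only: T_funpow_in_Y funpow_add o_apply add.commute[of _ ?j] simp_thms)
      also have "\<dots> < e / 2"
        using dist_triangle_half_l[of "(T ^^ s0 q) p" q "e / 2" "(T ^^ s) p"] s0 q by simp
      finally have "dist ((T ^^ (s0 q + ?j)) p) ((T ^^ (s + ?j)) p) < e / 2" .
      moreover have "dist ((T ^^ (s0 q + ?j)) p) r < e / 4"
        using J[OF \<open>r \<in> P\<close>, of q] by (simp add: B_def)
      ultimately have "dist y ((T ^^ (s + ?j)) p) < e"
        using r(2) dist_triangle[of y "(T ^^ (s + ?j)) p" r]
          dist_triangle[of r "(T ^^ (s + ?j)) p" "(T ^^ (s0 q + ?j)) p"]
        by (simp add: dist_commute)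
      then show "\<exists>j\<le>R. dist y ((T ^^ (s + j)) p) < e"
        using R[OF q(1) r(1)] by blast
    qed
  qed
  with p show ?thesis by blast
qed

section \<open>Measurable sets are locally constant off a small set\<close>

definition agree :: "nat \<Rightarrow> real \<Rightarrow> (nat \<Rightarrow> nat) \<times> 'y \<Rightarrow> (nat \<Rightarrow> nat) \<times> 'y \<Rightarrow> bool" where
  "agree L e z w \<longleftrightarrow> (\<forall>j<L. fst z j = fst w j) \<and> dist (snd z) (snd w) < e"

text \<open>A form of Lusin's theorem for the indicator of \<open>A\<close>: off a small set,
  finitely many symbols and an approximate position decide membership. Both points compared have to
  lie in the good set \<open>G\<close>.\<close>

definition almost_locally_constant :: "((nat \<Rightarrow> nat) \<times> 'y) set \<Rightarrow> bool" where
  "almost_locally_constant A \<longleftrightarrow> (\<forall>e>0. \<exists>L d G. 0 < d \<and> G \<in> sets \<mu> \<and> measure \<mu> (space \<mu> - G) < e \<and>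
     (\<forall>z\<in>G. \<forall>w\<in>G. agree L d z w \<longrightarrow> (z \<in> A \<longleftrightarrow> w \<in> A)))"

lemma almost_locally_constantD:
  assumes "almost_locally_constant A" "0 < e"
  shows "\<exists>L d G. 0 < d \<and> G \<in> sets \<mu> \<and> measure \<mu> (space \<mu> - G) < e \<and>
     (\<forall>z\<in>G. \<forall>w\<in>G. agree L d z w \<longrightarrow> (z \<in> A \<longleftrightarrow> w \<in> A))"
  using assms unfolding almost_locally_constant_def by simp

lemma almost_locally_constant_Diff:
  assumes "almost_locally_constant A"
  shows "almost_locally_constant (space \<mu> - A)"
  unfolding almost_locally_constant_def
proof (intro allI impI)
  fix e :: real assume "0 < e"
  from almost_locally_constantD[OF assms this]
  obtain L d G where *: "0 < d" "G \<in> sets \<mu>" "measure \<mu> (space \<mu> - G) < e"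
    "\<forall>z\<in>G. \<forall>w\<in>G. agree L d z w \<longrightarrow> (z \<in> A \<longleftrightarrow> w \<in> A)"
    by (elim exE conjE)
  have "z \<in> space \<mu> - A \<longleftrightarrow> w \<in> space \<mu> - A" if "z \<in> G" "w \<in> G" "agree L d z w" for z w
    using *(4) that subsetD[OF sets.sets_into_space[OF *(2)]] by simp
  with *(1-3) show "\<exists>L d G. 0 < d \<and> G \<in> sets \<mu> \<and> measure \<mu> (space \<mu> - G) < e \<and>
      (\<forall>z\<in>G. \<forall>w\<in>G. agree L d z w \<longrightarrow> (z \<in> space \<mu> - A \<longleftrightarrow> w \<in> space \<mu> - A))"
    by (intro exI[of _ L] exI[of _ d] exI[of _ G]) simp
qed

text \<open>Up to the small tail \<open>D n\<close> the union is a finite one. Intersect the good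
  sets of its finitely many members and take the strictest \<open>L\<close> and
  \<open>d\<close>.\<close>

lemma almost_locally_constant_Union:
  fixes A :: "nat \<Rightarrow> ((nat \<Rightarrow> nat) \<times> 'y) set"
  assumes A: "\<And>i. A i \<in> sets \<mu>" "\<And>i. almost_locally_constant (A i)"
  shows "almost_locally_constant (\<Union>i. A i)"
  unfolding almost_locally_constant_def
proof (intro allI impI)
  fix e :: real assume e: "0 < e"
  note [measurable] = A(1)
  define D where "D n = (\<Union>i. A i) - (\<Union>i<n. A i)" for n
  have D [measurable]: "D n \<in> sets \<mu>" for n
    unfolding D_def by measurable
  have "(\<lambda>n. measure \<mu> (D n)) \<longlonglongrightarrow> measure \<mu> (\<Inter>n. D n)"
  proof (rule coin_m.finite_Lim_measure_decseq)
    show "range D \<subseteq> sets \<mu>" using D by blast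
    show "decseq D" unfolding decseq_def D_def by (auto intro: less_le_trans)
  qed
  moreover have "(\<Inter>n. D n) = {}"
    by (auto simp: D_def)
  ultimately have "eventually (\<lambda>n. measure \<mu> (D n) < e / 2) sequentially"
    using e by (intro order_tendstoD(2)[of _ 0]) auto
  then obtain n where n: "measure \<mu> (D n) < e / 2"
    using eventually_sequentially by auto
  \<comment> \<open>The \<open>+ 1\<close> covers \<open>n = 0\<close>, as do the inserted 0 and 1
    in \<open>L'\<close> and \<open>d'\<close> below.\<close>
  define e' where "e' = e / (2 * (real n + 1))"
  have e': "0 < e'" "real n * e' \<le> e / 2"
    using e by (auto simp: e'_def field_simps)
  have "\<exists>L d G. 0 < d \<and> G \<in> sets \<mu> \<and> measure \<mu> (space \<mu> - G) < e' \<and>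
      (\<forall>z\<in>G. \<forall>w\<in>G. agree L d z w \<longrightarrow> (z \<in> A i \<longleftrightarrow> w \<in> A i))" for i
    by (rule almost_locally_constantD) (use A(2) e' in auto)
  then obtain L d G where d: "\<And>i. 0 < d i" and G [measurable]: "\<And>i. G i \<in> sets \<mu>"
    and G_meas: "\<And>i. measure \<mu> (space \<mu> - G i) < e'"
    and G_const: "\<And>i z w. z \<in> G i \<Longrightarrow> w \<in> G i \<Longrightarrow> agree (L i) (d i) z w \<Longrightarrow> z \<in> A i \<longleftrightarrow> w \<in> A i"
    by metis
  define H where "H = (space \<mu> - D n) - (\<Union>i<n. space \<mu> - G i)"
  define L' where "L' = Max (insert 0 (L ` {..<n}))"
  define d' where "d' = Min (insert 1 (d ` {..<n}))"
  have L': "L i \<le> L'" and d': "d' \<le> d i" if "i < n" for i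
    using that by (auto simp: L'_def d'_def)
  show "\<exists>L d G. 0 < d \<and> G \<in> sets \<mu> \<and> measure \<mu> (space \<mu> - G) < e \<and>
      (\<forall>z\<in>G. \<forall>w\<in>G. agree L d z w \<longrightarrow> (z \<in> (\<Union>i. A i) \<longleftrightarrow> w \<in> (\<Union>i. A i)))"
  proof (intro exI conjI ballI impI)
    show "0 < d'"
      using d by (auto simp: d'_def)
    show "H \<in> sets \<mu>"
      unfolding H_def by measurable
    have "space \<mu> - H \<subseteq> D n \<union> (\<Union>i<n. space \<mu> - G i)"
      by (auto simp: H_def)
    then have "measure \<mu> (space \<mu> - H) \<le> measure \<mu> (D n \<union> (\<Union>i<n. space \<mu> - G i))"
      by (rule coin_m.finite_measure_mono) measurable
    also have "\<dots> \<le> measure \<mu> (D n) + measure \<mu> (\<Union>i<n. space \<mu> - G i)"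
      by (rule measure_Un_le) measurable
    also have "measure \<mu> (\<Union>i<n. space \<mu> - G i) \<le> (\<Sum>i<n. measure \<mu> (space \<mu> - G i))"
      by (rule coin_m.finite_measure_subadditive_finite) auto
    also have "\<dots> \<le> real n * e'"
      using sum_bounded_above[of "{..<n}" "\<lambda>i. measure \<mu> (space \<mu> - G i)" e'] G_meas less_imp_le by fastforce
    finally show "measure \<mu> (space \<mu> - H) < e"
      using n e' by linarith
  next
    fix z w assume z: "z \<in> H" and w: "w \<in> H" and zw: "agree L' d' z w"
    have "z \<in> A i \<longleftrightarrow> w \<in> A i" if i: "i < n" for i
    proof (rule G_const)
      show "z \<in> G i" "w \<in> G i"
        using z w i by (auto simp: H_def)
      show "agree (L i) (d i) z w"
        using zw L'[OF i] d'[OF i] by (auto simp: agree_def)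
    qed
    moreover have "z \<in> (\<Union>i. A i) \<longleftrightarrow> z \<in> (\<Union>i<n. A i)" "w \<in> (\<Union>i. A i) \<longleftrightarrow> w \<in> (\<Union>i<n. A i)"
      using z w by (auto simp: H_def D_def)
    ultimately show "z \<in> (\<Union>i. A i) \<longleftrightarrow> w \<in> (\<Union>i. A i)"
      by auto
  qed
qed

lemma almost_locally_constant_symbol:
  "almost_locally_constant {z \<in> space \<mu>. fst z i \<in> E}"
  unfolding almost_locally_constant_def
  by (intro allI impI exI[of _ "Suc i"] exI[of _ 1] exI[of _ "space \<mu>"]) (auto simp: agree_def)

lemma snd_borel: "snd \<in> borel_measurable \<mu>"
  by (rule measurable_compose[OF measurable_snd borel_measurable_id_m])

text \<open>The points of \<open>V\<close> at distance less than \<open>1 / Suc n\<close> from the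
  complement form sets \<open>D n\<close> decreasing to the empty set. Every other point of
  \<open>V\<close> has its whole \<open>1 / Suc n\<close>-ball inside \<open>V\<close>.\<close>

lemma almost_locally_constant_open:
  assumes "open V"
  shows "almost_locally_constant {z \<in> space \<mu>. snd z \<in> V}"
  unfolding almost_locally_constant_def
proof (intro allI impI)
  fix e :: real assume e: "0 < e"
  let ?f = "\<lambda>z. infdist (snd z) (- V)"
  have f [measurable]: "?f \<in> borel_measurable \<mu>"
    by (intro measurable_compose[OF snd_borel] borel_measurable_continuous_onI continuous_intros)
  define D where "D n = {z \<in> space \<mu>. 0 < ?f z \<and> ?f z < 1 / real (Suc n)}" for n
  have D [measurable]: "D n \<in> sets \<mu>" for n
    unfolding D_def by measurable
  have "D (Suc n) \<subseteq> D n" for n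
  proof -
    have "1 / real (Suc (Suc n)) \<le> 1 / real (Suc n)"
      by (intro divide_left_mono) auto
    then show ?thesis
      unfolding D_def by (auto intro: less_le_trans)
  qed
  then have "decseq D"
    by (rule decseq_SucI)
  then have "(\<lambda>n. measure \<mu> (D n)) \<longlonglongrightarrow> measure \<mu> (\<Inter>n. D n)"
    using D by (intro coin_m.finite_Lim_measure_decseq) blast+
  moreover have "(\<Inter>n. D n) = {}"
  proof (rule equals0I)
    fix z assume "z \<in> (\<Inter>n. D n)"
    then have "0 < ?f z" "\<And>n. ?f z < 1 / real (Suc n)"
      by (auto simp: D_def)
    then show False
      using reals_Archimedean[of "?f z"] by (metis inverse_eq_divide less_asym)
  qed
  ultimately have "eventually (\<lambda>n. measure \<mu> (D n) < e) sequentially"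
    using e by (intro order_tendstoD(2)[of _ 0]) auto
  then obtain n where n: "measure \<mu> (D n) < e"
    using eventually_sequentially by auto
  show "\<exists>L d G. 0 < d \<and> G \<in> sets \<mu> \<and> measure \<mu> (space \<mu> - G) < e \<and>
      (\<forall>z\<in>G. \<forall>w\<in>G. agree L d z w \<longrightarrow>
        (z \<in> {z \<in> space \<mu>. snd z \<in> V} \<longleftrightarrow> w \<in> {z \<in> space \<mu>. snd z \<in> V}))"
  proof (intro exI[of _ "0::nat"] exI[of _ "1 / real (Suc n)"] exI[of _ "space \<mu> - D n"] conjI ballI impI)
    show "measure \<mu> (space \<mu> - (space \<mu> - D n)) < e"
      using n sets.sets_into_space[OF D[of n]] by (simp add: double_diff)
    have "z \<in> V \<Longrightarrow> w \<notin> V \<Longrightarrow> False"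
      if "a \<in> space \<mu> - D n" "snd a = z" "dist z w < 1 / real (Suc n)" for a z w
    proof -
      assume zw: "z \<in> V" "w \<notin> V"
      have "infdist w (- V) = 0"
        using zw by simp
      then have "infdist z (- V) < 1 / real (Suc n)"
        using infdist_triangle[of z "- V" w] that by (simp add: dist_commute)
      then have "infdist z (- V) = 0"
        using that infdist_nonneg[of z "- V"] by (force simp: D_def)
      moreover have "closed (- V)" "- V \<noteq> {}"
        using assms zw by auto
      ultimately show False
        using zw in_closed_iff_infdist_zero by blast
    qed
    then show "z \<in> {z \<in> space \<mu>. snd z \<in> V} \<longleftrightarrow> w \<in> {z \<in> space \<mu>. snd z \<in> V}"
      if "z \<in> space \<mu> - D n" "w \<in> space \<mu> - D n" "agree 0 (1 / real (Suc n)) z w" for z w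
      using that by (metis (mono_tags, lifting) Diff_iff agree_def dist_commute mem_Collect_eq)
  qed auto
qed

text \<open>The measurable sets with this property form a sigma-algebra that makes both projections
  measurable, hence contains the product sigma-algebra. For the second projection open sets
  suffice.\<close>

lemma almost_locally_constant_measurable:
  assumes "A \<in> sets \<mu>"
  shows "almost_locally_constant A"
proof -
  define \<G> where "\<G> = {A \<in> sets \<mu>. almost_locally_constant A}"
  have \<G>: "\<G> \<subseteq> Pow (space \<mu>)"
    using sets.sets_into_space by (auto simp: \<G>_def)
  interpret \<G>: sigma_algebra "space \<mu>" \<G>
    unfolding sigma_algebra_iff2
  proof (intro conjI ballI allI impI)
    show "{} \<in> \<G>"
      using almost_locally_constant_symbol[of 0 "{}"] by (simp add: \<G>_def)
    show "space \<mu> - B \<in> \<G>" if "B \<in> \<G>" for B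
      using that almost_locally_constant_Diff by (auto simp: \<G>_def)
    show "(\<Union>i. B i) \<in> \<G>" if "range B \<subseteq> \<G>" for B :: "nat \<Rightarrow> _"
      using that by (auto simp: \<G>_def subset_eq intro!: almost_locally_constant_Union)
  qed (use \<G> in auto)
  define M' where "M' = measure_of (space \<mu>) \<G> (\<lambda>_. 0)"
  have M': "space M' = space \<mu>" "sets M' = \<G>"
    using \<G> \<G>.sets_measure_of_eq by (auto simp: M'_def space_measure_of)
  have "fst \<in> M' \<rightarrow>\<^sub>M coin_measure"
  proof (rule measurable_into_coin)
    fix i
    have "{z \<in> space \<mu>. fst z i \<in> E} \<in> \<G>" for E
      using almost_locally_constant_symbol by (auto simp: \<G>_def)
    then show "(\<lambda>z. fst z i) \<in> M' \<rightarrow>\<^sub>M count_space UNIV"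
      by (intro measurableI) (auto simp: M' vimage_def Int_def conj_commute)
  qed (use bit_\<mu> M' in auto)
  moreover have "snd \<in> M' \<rightarrow>\<^sub>M m"
  proof (rule measurable_into_m)
    show "snd \<in> borel_measurable M'"
    proof (rule borel_measurableI)
      fix V :: "'y set" assume V: "open V"
      have "snd -` V \<inter> space \<mu> \<in> sets \<mu>"
        by (rule measurable_sets[OF snd_borel]) (use V in auto)
      moreover have "snd -` V \<inter> space \<mu> = {z \<in> space \<mu>. snd z \<in> V}"
        by auto
      ultimately show "snd -` V \<inter> space M' \<in> sets M'"
        using almost_locally_constant_open[OF V] by (simp add: \<G>_def M')
    qed
  qed (auto simp: M' space_\<mu>)
  ultimately have "(\<lambda>z. (fst z, snd z)) \<in> M' \<rightarrow>\<^sub>M \<mu>"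
    by (intro measurable_Pair)
  then have "(\<lambda>z. (fst z, snd z)) -` A \<inter> space M' \<in> sets M'"
    using assms by (rule measurable_sets)
  then show ?thesis
    using sets.sets_into_space[OF assms] by (simp add: M' \<G>_def Int_absorb2)
qed

definition labels :: "((nat \<Rightarrow> nat) \<times> 'y \<Rightarrow> bool) \<Rightarrow> nat \<Rightarrow> (nat \<Rightarrow> nat) \<times> 'y \<Rightarrow> nat list" where
  "labels f n z = map (\<lambda>i. flip_label f ((S ^^ i) z)) [0..<n]"

lemma AE_snd:
  assumes "AE y in m. P y"
  shows "AE z in \<mu>. P (snd z)"
proof -
  from assms obtain N where N: "N \<in> null_sets m" "{y \<in> space m. \<not> P y} \<subseteq> N"
    by (auto simp: eventually_ae_filter)
  have "space coin_measure \<times> N \<in> null_sets \<mu>"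
    using N(1) by (auto simp: null_sets_def m.emeasure_pair_measure_Times)
  then show ?thesis
    by (rule AE_I') (use N(2) in \<open>auto simp: space_\<mu>\<close>)
qed

end

subsection \<open>The block code\<close>

text \<open>State \<open>None\<close> means waiting for a symbol 1; \<open>Some c\<close> means inside a block of \<open>N\<close> steps, where \<open>c\<close>
  lists the symbols of the canonical point since the start of the block, most recent first. Inside
  a block the actual symbol \<open>x\<close> does not influence the timing, so actual symbols and labels, which
  agree outside blocks, drive the automaton through the same phases; \<open>N\<close> zeros reset it.\<close>

definition block_step :: "nat \<Rightarrow> (nat list \<Rightarrow> nat) \<Rightarrow> nat \<Rightarrow> nat list option \<Rightarrow> nat list option" where
  "block_step N f x q = (case q of
      None \<Rightarrow> if x = 1 then Some [] else None
    | Some c \<Rightarrow> if Suc (length c) < N then Some (f c # c) else None)"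

definition valid_state :: "nat \<Rightarrow> nat list option \<Rightarrow> bool" where
  "valid_state N q \<longleftrightarrow> (\<forall>c. q = Some c \<longrightarrow> length c < N \<and> set c \<subseteq> {0, 1})"

text \<open>Time until the current block ends. It decreases to 0 while zeros are read, because a
  zero starts no new block.\<close>

definition remaining :: "nat \<Rightarrow> nat list option \<Rightarrow> nat" where
  "remaining N q = (case q of None \<Rightarrow> 0 | Some c \<Rightarrow> N - length c)"

lemma valid_state_None [simp]: "valid_state N None"
  by (simp add: valid_state_def)

lemma valid_state_block_step:
  "valid_state N q \<Longrightarrow> (\<And>c. f c \<in> {0, 1}) \<Longrightarrow> 0 < N \<Longrightarrow> valid_state N (block_step N f x q)"
  by (auto simp: valid_state_def block_step_def split: option.splits if_splits)

lemma remaining_block_step: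
  "remaining N (block_step N f 0 q) \<le> remaining N q - 1"
  by (auto simp: remaining_def block_step_def split: option.splits)

lemma remaining_le: "remaining N q \<le> N"
  by (auto simp: remaining_def split: option.splits)

lemma remaining_0: "valid_state N q \<Longrightarrow> remaining N q = 0 \<Longrightarrow> q = None"
  by (auto simp: remaining_def valid_state_def split: option.splits)

lemma block_step_eq_Nil: "block_step N f x q = Some [] \<longleftrightarrow> q = None \<and> x = 1"
  by (auto simp: block_step_def split: option.splits)

lemma block_step_eq_Cons:
  "block_step N f x q = Some (a # c) \<longleftrightarrow> q = Some c \<and> a = f c \<and> Suc (length c) < N"
  by (auto simp: block_step_def split: option.splits)

lemma sum_list_bits: "set c \<subseteq> {0, 1::nat} \<Longrightarrow> sum_list c \<le> length c"
  by (induction c) auto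

text \<open>\<open>V\<close> will be the given rule transferred to canonical points, and
  \<open>d\<close> the distance at which two points count as coupled. That the orbit of
  \<open>p\<close> comes close to other points enters as the hypothesis \<open>hit\<close> of the
  coupling lemmas.\<close>

locale block_code = ergodic_isometry Y m T
  for Y :: "'y::metric_space set" and m T +
  fixes N :: nat and d :: real and p :: 'y and V :: "(nat \<Rightarrow> nat) \<times> 'y \<Rightarrow> bool"
  assumes N_pos: "0 < N" and p_in_Y: "p \<in> Y"
begin

text \<open>The canonical point starts at \<open>(T ^^ N) p\<close>, so that its position after the symbols \<open>c\<close>, which is
  an inverse image under \<open>T ^^ sum_list c\<close>, can be written without inverting \<open>T\<close>.\<close>

definition canon :: "nat list \<Rightarrow> (nat \<Rightarrow> nat) \<times> 'y" where
  "canon c = (\<lambda>j. if j < length c then c ! j else 0, (T ^^ (N - sum_list c)) p)"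

definition close :: "nat list \<Rightarrow> 'y \<Rightarrow> bool" where
  "close c y \<longleftrightarrow> dist y (snd (canon c)) < d"

text \<open>Time runs backwards: the state at \<open>z\<close> arises from the state at
  \<open>S z\<close>. The function passed to \<open>block_step\<close> is the coupling rule: the
  canonical symbol equals the actual one if the points are close and is opposite otherwise.\<close>

definition step :: "(nat \<Rightarrow> nat) \<times> 'y \<Rightarrow> nat list option \<Rightarrow> nat list option" where
  "step z = block_step N (\<lambda>c. if close c (snd (S z)) then fst z 0 else 1 - fst z 0) (fst z 0)"

primrec run :: "nat \<Rightarrow> nat list option \<Rightarrow> (nat \<Rightarrow> nat) \<times> 'y \<Rightarrow> nat list option" where
  "run 0 q z = q"
| "run (Suc n) q z = step z (run n q (S z))"

definition zero_run :: "(nat \<Rightarrow> nat) \<Rightarrow> nat \<Rightarrow> bool" where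
  "zero_run x n \<longleftrightarrow> (\<forall>j<N. x (n + j) = 0)"

text \<open>Once \<open>N\<close> zeros have been read the automaton is waiting, whatever happened
  before. Starting in \<open>None\<close> there gives the state for an infinite past;
  \<open>LEAST\<close> picks the most recent such moment.\<close>

definition state :: "(nat \<Rightarrow> nat) \<times> 'y \<Rightarrow> nat list option" where
  "state z = run (LEAST n. zero_run (fst z) n) None z"

text \<open>Asking for infinitely many zero runs, not just one, makes the property invariant under
  \<open>S\<close>.\<close>

definition sync :: "(nat \<Rightarrow> nat) \<times> 'y \<Rightarrow> bool" where
  "sync z \<longleftrightarrow> z \<in> space \<mu> \<and> (\<forall>n. \<exists>i\<ge>n. zero_run (fst z) i)"

text \<open>In a block the rule is chosen so that the label equals the canonical symbol, flipped if \<open>V\<close> holds at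
  the canonical point: hence \<open>decode_step\<close> below reconstructs the states from the labels.\<close>

definition code :: "(nat \<Rightarrow> nat) \<times> 'y \<Rightarrow> bool" where
  "code z \<longleftrightarrow> (case state z of None \<Rightarrow> False | Some c \<Rightarrow> V (canon c) \<longleftrightarrow> close c (snd z))"

definition decode_step :: "nat \<Rightarrow> nat list option \<Rightarrow> nat list option" where
  "decode_step l = block_step N (\<lambda>c. if V (canon c) then 1 - l else l) l"

section \<open>The state is well defined and obeys the step recursion\<close>

lemma valid_step: "z \<in> space \<mu> \<Longrightarrow> valid_state N q \<Longrightarrow> valid_state N (step z q)"
  unfolding step_def using bit_\<mu>[of z 0] N_pos by (intro valid_state_block_step) auto

lemma S_in_space: "z \<in> space \<mu> \<Longrightarrow> S z \<in> space \<mu>"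
  using measurable_space[OF measurable_S] .

lemma valid_run: "z \<in> space \<mu> \<Longrightarrow> valid_state N q \<Longrightarrow> valid_state N (run n q z)"
  by (induction n arbitrary: z) (simp_all add: valid_step S_in_space)

lemma run_add: "run (n + k) q z = run n (run k q ((S ^^ n) z)) z"
  by (induction n arbitrary: z) (auto simp: funpow_swap1)

lemma remaining_run: "(\<And>j. j < n \<Longrightarrow> fst z j = 0) \<Longrightarrow> remaining N (run n q z) \<le> remaining N q - n"
proof (induction n arbitrary: z)
  case (Suc n)
  have "remaining N (run (Suc n) q z) \<le> remaining N (run n q (S z)) - 1"
    unfolding run.simps step_def Suc.prems[of 0, OF zero_less_Suc] by (rule remaining_block_step)
  also have "remaining N (run n q (S z)) \<le> remaining N q - n"
    by (rule Suc.IH) (use Suc.prems in \<open>auto simp: fst_S left_shift_def\<close>)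
  finally show ?case by simp
qed simp

text \<open>Whatever state precedes the \<open>N\<close> zeros is forgotten when they have been
  read, so a more remote start gives the same result as \<open>None\<close> at index
  \<open>n\<close>.\<close>

lemma run_zero_run:
  assumes z: "z \<in> space \<mu>" and n: "zero_run (fst z) n" and k: "n + N \<le> k"
  shows "run k None z = run n None z"
proof -
  define w where "w = (S ^^ n) z"
  have w: "w \<in> space \<mu>"
    unfolding w_def by (rule symbols.S_funpow_space[OF z])
  let ?q = "run (k - n - N) None ((S ^^ N) w)"
  have "valid_state N (run N ?q w)"
    by (intro valid_run w symbols.S_funpow_space) simp
  moreover have "remaining N (run N ?q w) = 0"
    using remaining_run[of N w ?q] remaining_le[of N ?q] n
    by (simp add: w_def fst_S_funpow zero_run_def)
  ultimately have "run N ?q w = None"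
    by (rule remaining_0)
  moreover have "k = n + (N + (k - n - N))"
    using k by simp
  ultimately show ?thesis
    using run_add[of n "N + (k - n - N)" None z] run_add[of N "k - n - N" None w]
    by (simp add: w_def)
qed

lemma run_eq_state:
  assumes z: "z \<in> space \<mu>" and n: "zero_run (fst z) n" and k: "n + N \<le> k"
  shows "run k None z = state z"
  unfolding state_def
proof (rule run_zero_run[OF z])
  show "zero_run (fst z) (LEAST n. zero_run (fst z) n)"
    using n by (rule LeastI)
  show "(LEAST n. zero_run (fst z) n) + N \<le> k"
    using Least_le[of "zero_run (fst z)", OF n] k by simp
qed

lemma sync_S: "sync z \<Longrightarrow> sync (S z)"
  unfolding sync_def
proof (intro conjI allI)
  fix n assume z: "z \<in> space \<mu> \<and> (\<forall>n. \<exists>i\<ge>n. zero_run (fst z) i)"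
  then show "S z \<in> space \<mu>"
    using S_in_space by simp
  obtain i where "Suc n \<le> i" "zero_run (fst z) i"
    using z by blast
  then show "\<exists>i\<ge>n. zero_run (fst (S z)) i"
    by (intro exI[of _ "i - 1"]) (auto simp: zero_run_def fst_S left_shift_def)
qed

lemma sync_S_funpow: "sync z \<Longrightarrow> sync ((S ^^ n) z)"
  by (induction n) (auto simp: sync_S)

lemma sync_space: "sync z \<Longrightarrow> z \<in> space \<mu>"
  by (simp add: sync_def)

lemma AE_sync: "AE z in \<mu>. sync z"
proof -
  have "AE z in \<mu>. \<exists>i. \<forall>j<N. fst ((S ^^ (i + j)) z) 0 = 0"
    by (rule symbols.AE_run) simp
  then have "AE z in \<mu>. \<forall>n. \<exists>i. \<forall>j<N. fst ((S ^^ (i + j)) ((S ^^ n) z)) 0 = 0"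
    by (rule symbols.AE_S_funpow)
  then show ?thesis
    using AE_space[of \<mu>]
  proof eventually_elim
    fix z assume *: "\<forall>n. \<exists>i. \<forall>j<N. fst ((S ^^ (i + j)) ((S ^^ n) z)) 0 = 0" and z: "z \<in> space \<mu>"
    have "\<exists>i\<ge>n. zero_run (fst z) i" for n
    proof -
      obtain i where "\<forall>j<N. fst ((S ^^ (i + j)) ((S ^^ n) z)) 0 = 0"
        using * by blast
      then have "zero_run (fst z) (n + i)"
        by (simp add: zero_run_def fst_S_funpow add.assoc)
      then show ?thesis
        by (intro exI[of _ "n + i"]) simp
    qed
    then show "sync z"
      using z by (simp add: sync_def)
  qed
qed

lemma state_rec:
  assumes "sync z"
  shows "state z = step z (state (S z))"
proof -
  \<comment> \<open>A zero run at an index of at least 1 is also seen from \<open>S z\<close>, so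
    both states can be computed from one common start.\<close>
  obtain i where i: "Suc 0 \<le> i" "zero_run (fst z) i"
    using assms unfolding sync_def by blast
  then have "zero_run (fst (S z)) (i - 1)"
    by (auto simp: zero_run_def fst_S left_shift_def)
  then have "run (i - 1 + N) None (S z) = state (S z)"
    using assms by (intro run_eq_state[of _ "i - 1"]) (auto simp: sync_def S_in_space)
  moreover have "run (i + N) None z = state z"
    using assms i by (intro run_eq_state[of _ i]) (auto simp: sync_def)
  moreover have "i + N = Suc (i - 1 + N)"
    using i by simp
  ultimately show ?thesis
    by (metis run.simps(2))
qed

lemma valid_state: "z \<in> space \<mu> \<Longrightarrow> valid_state N (state z)"
  unfolding state_def by (intro valid_run) auto

section \<open>Coupling of the actual and the canonical point inside a block\<close>

lemma state_Nil: "sync z \<Longrightarrow> state z = Some [] \<longleftrightarrow> state (S z) = None \<and> fst z 0 = 1"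
  by (subst state_rec) (auto simp: step_def block_step_eq_Nil)

lemma state_Cons:
  "sync z \<Longrightarrow> state z = Some (a # c) \<longleftrightarrow> state (S z) = Some c \<and> Suc (length c) < N \<and>
    a = (if close c (snd (S z)) then fst z 0 else 1 - fst z 0)"
  by (subst state_rec) (auto simp: step_def block_step_eq_Cons)

lemma state_drop:
  "sync z \<Longrightarrow> state z = Some c \<Longrightarrow> n \<le> length c \<Longrightarrow> state ((S ^^ n) z) = Some (drop n c)"
proof (induction n)
  case (Suc n)
  then have "state ((S ^^ n) z) = Some (c ! n # drop (Suc n) c)"
    by (simp add: Cons_nth_drop_Suc)
  then show ?case
    using state_Cons[OF sync_S_funpow[OF Suc.prems(1), of n]] by simp
qed simp

text \<open>The list grows at its head as the walk moves to smaller indices, so entry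
  \<open>n\<close> of the list belongs to coordinate \<open>n\<close> of the sequence.\<close>

lemma state_nth:
  assumes "sync z" "state z = Some c" "n < length c"
  shows "c ! n = (if close (drop (Suc n) c) (snd ((S ^^ Suc n) z)) then fst z n else 1 - fst z n)"
proof -
  have "state ((S ^^ n) z) = Some (c ! n # drop (Suc n) c)"
    using assms state_drop[of z c n] by (simp add: Cons_nth_drop_Suc)
  then show ?thesis
    using state_Cons[OF sync_S_funpow[OF assms(1), of n]] by (simp add: fst_S_funpow)
qed

lemma snd_in_Y: "z \<in> space \<mu> \<Longrightarrow> snd z \<in> Y"
  by (auto simp: space_\<mu>)

text \<open>Close points use the same symbol \<open>a\<close>, and the old positions are the images
  of the new ones under the isometry \<open>T ^^ a\<close>. The bound
  \<open>sum_list (a # c) < N\<close> prevents truncation in the exponent of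
  \<open>canon\<close>.\<close>

lemma close_Cons:
  assumes z: "sync z" "state z = Some (a # c)" and c: "close c (snd (S z))"
  shows "close (a # c) (snd z)"
proof -
  have a: "a = fst z 0"
    using z c state_Cons by simp
  have "valid_state N (Some (a # c))"
    using valid_state[OF sync_space[OF z(1)]] z(2) by simp
  then have "sum_list (a # c) < N"
    using sum_list_bits[of "a # c"] by (auto simp: valid_state_def)
  then have "N - sum_list c = a + (N - sum_list (a # c))"
    by simp
  then have "snd (canon c) = (T ^^ a) (snd (canon (a # c)))"
    by (simp only: canon_def snd_conv funpow_add o_apply)
  moreover have "snd (canon (a # c)) \<in> Y"
    by (simp add: canon_def T_funpow_in_Y p_in_Y)
  ultimately show ?thesis
    using c snd_in_Y[OF sync_space[OF z(1)]] by (simp add: close_def snd_S a dist_T_funpow)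
qed

lemma close_drop_mono:
  assumes z: "sync z" "state z = Some c" and n: "n \<le> length c"
    and c: "close (drop n c) (snd ((S ^^ n) z))" and k: "k \<le> n"
  shows "close (drop k c) (snd ((S ^^ k) z))"
  using k
proof (induction rule: inc_induct)
  case base
  show ?case by (rule c)
next
  case (step k)
  have "state ((S ^^ k) z) = Some (c ! k # drop (Suc k) c)"
    using z n step.hyps state_drop[of z c k] by (simp add: Cons_nth_drop_Suc)
  then have "close (c ! k # drop (Suc k) c) (snd ((S ^^ k) z))"
    using step.IH by (intro close_Cons) (auto simp: sync_S_funpow z)
  then show ?case
    using n step.hyps by (simp add: Cons_nth_drop_Suc)
qed

text \<open>As long as the point and the canonical point are not close they use opposite symbols, so
  along a run of ones the canonical point rests while the point visits a whole orbit segment.\<close>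

lemma close_after_ones:
  assumes z: "sync z" "state z = Some c" and len: "i + R \<le> length c"
    and ones: "\<And>j. j < R \<Longrightarrow> fst z (i + j) = 1"
    and hit: "\<forall>s. \<exists>k\<le>R. dist (snd ((S ^^ (i + R)) z)) ((T ^^ (s + k)) p) < d"
  shows "close (drop i c) (snd ((S ^^ i) z))"
proof (rule ccontr)
  assume far: "\<not> close (drop i c) (snd ((S ^^ i) z))"
  have far_n: "\<not> close (drop n c) (snd ((S ^^ n) z))" if "i \<le> n" "n \<le> i + R" for n
    using close_drop_mono[OF z, of n i] far that len by auto
  \<comment> \<open>Going down from index \<open>i + R\<close>, every actual symbol is 1 and its
    canonical opposite is 0: the canonical point rests while the actual point moves back along its
    \<open>T\<close>-orbit.\<close>
  have inv: "sum_list (drop (i + R - k) c) = sum_list (drop (i + R) c) \<and>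
      (T ^^ k) (snd ((S ^^ (i + R - k)) z)) = snd ((S ^^ (i + R)) z)" if "k \<le> R" for k
    using that
  proof (induction k)
    case (Suc k)
    define n where "n = i + R - Suc k"
    have n: "i + R - k = Suc n" "n < length c" "i \<le> n" "n < i + R"
      using Suc.prems len by (auto simp: n_def)
    have x: "fst z n = 1"
      using ones[of "n - i"] n by simp
    have "c ! n = 0"
      using state_nth[OF z n(2)] far_n[of "Suc n"] n x by simp
    then have "sum_list (drop n c) = sum_list (drop (Suc n) c)"
      using Cons_nth_drop_Suc[OF n(2)] by (metis add_0 sum_list.Cons)
    moreover have "snd ((S ^^ Suc n) z) = T (snd ((S ^^ n) z))"
      using x by (simp add: snd_S fst_S_funpow)
    ultimately show ?case
      using Suc n by (simp add: n_def[symmetric] funpow_swap1)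
  qed simp
  let ?s = "N - sum_list (drop (i + R) c)"
  obtain k where k: "k \<le> R" "dist (snd ((S ^^ (i + R)) z)) ((T ^^ (?s + k)) p) < d"
    using hit by blast
  \<comment> \<open>Applying \<open>T ^^ k\<close> to both points turns their distance at index
    \<open>i + R - k\<close> into the distance bounded by \<open>hit\<close>.\<close>
  have "dist (snd ((S ^^ (i + R - k)) z)) (snd (canon (drop (i + R - k) c))) =
      dist (snd ((S ^^ (i + R - k)) z)) ((T ^^ ?s) p)"
    using inv[OF k(1)] by (simp add: canon_def)
  also have "\<dots> = dist ((T ^^ k) (snd ((S ^^ (i + R - k)) z))) ((T ^^ k) ((T ^^ ?s) p))"
    using z by (intro dist_T_funpow[symmetric] snd_in_Y sync_space sync_S_funpow T_funpow_in_Y p_in_Y)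
  also have "(T ^^ k) ((T ^^ ?s) p) = (T ^^ (?s + k)) p"
    by (simp only: add.commute[of ?s k] funpow_add o_apply)
  also have "(T ^^ k) (snd ((S ^^ (i + R - k)) z)) = snd ((S ^^ (i + R)) z)"
    using inv[OF k(1)] by simp
  finally have "close (drop (i + R - k) c) (snd ((S ^^ (i + R - k)) z))"
    using k(2) by (simp add: close_def)
  then show False
    using far_n[of "i + R - k"] k(1) by simp
qed

text \<open>While waiting, the label is the actual symbol. In a block the label is flipped iff
  \<open>V\<close> and closeness agree, the canonical symbol iff the points are not close; so the
  two differ exactly when \<open>V\<close> holds, which \<open>decode_step\<close> undoes.\<close>

lemma flip_label_code_state:
  assumes "sync z"
  shows "state z = decode_step (flip_label code z) (state (S z))"
proof (cases "state (S z)")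
  case None
  then have "flip_label code z = fst z 0"
    by (simp add: flip_label_def code_def)
  with None show ?thesis
    by (subst state_rec[OF assms]) (simp add: step_def decode_step_def block_step_def)
next
  case (Some c)
  have x: "fst z 0 \<in> {0, 1}"
    using bit_\<mu> sync_space[OF assms] by blast
  have "flip_label code z = (if V (canon c) \<longleftrightarrow> close c (snd (S z)) then 1 - fst z 0 else fst z 0)"
    by (simp add: flip_label_def code_def Some)
  with Some x show ?thesis
    by (subst state_rec[OF assms]) (auto simp: step_def decode_step_def block_step_def)
qed

section \<open>Measurability of the state and of the code\<close>

lemma measurable_close [measurable]: "Measurable.pred \<mu> (\<lambda>z. close c (snd z))"
proof -
  have "(\<lambda>z. dist (snd z) (snd (canon c))) \<in> borel_measurable \<mu>"
    by (rule measurable_compose[OF measurable_snd borel_measurable_dist_m])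
  then show ?thesis
    unfolding close_def by measurable
qed

text \<open>States form a countable type, so it suffices to fix \<open>q\<close>; the step then
  depends on \<open>z\<close> only through one truth value and one symbol.\<close>

lemma measurable_step: "(\<lambda>z. step z q) \<in> \<mu> \<rightarrow>\<^sub>M count_space UNIV"
proof (cases q)
  case None
  have "(\<lambda>z. if fst z 0 = 1 then Some [] else None) \<in> \<mu> \<rightarrow>\<^sub>M count_space UNIV"
    by measurable
  then show ?thesis
    by (simp add: step_def block_step_def None)
next
  case (Some c)
  have "Measurable.pred \<mu> (\<lambda>z. close c (snd (S z)))"
    by (rule measurable_compose[OF measurable_S measurable_close])
  then have "(\<lambda>z. (close c (snd (S z)), fst z 0)) \<in> \<mu> \<rightarrow>\<^sub>M count_space UNIV \<Otimes>\<^sub>M count_space UNIV"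
    by (rule measurable_Pair[OF _ measurable_symbol])
  then have "(\<lambda>z. (close c (snd (S z)), fst z 0)) \<in> \<mu> \<rightarrow>\<^sub>M count_space UNIV"
    by (simp add: pair_measure_countable)
  then have "(\<lambda>z. (\<lambda>(b, x). block_step N (\<lambda>_. if b then x else 1 - x) x q) (close c (snd (S z)), fst z 0))
      \<in> \<mu> \<rightarrow>\<^sub>M count_space UNIV"
    by (rule measurable_compose) simp
  then show ?thesis
    by (simp add: step_def block_step_def Some)
qed

lemma measurable_run: "run n q \<in> \<mu> \<rightarrow>\<^sub>M count_space UNIV"
proof (induction n)
  case (Suc n)
  have "(\<lambda>z. run n q (S z)) \<in> \<mu> \<rightarrow>\<^sub>M count_space UNIV"
    by (rule measurable_compose[OF measurable_S Suc])
  then have "(\<lambda>z. step z (run n q (S z))) \<in> \<mu> \<rightarrow>\<^sub>M count_space UNIV"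
    by (rule measurable_compose_countable[OF measurable_step])
  then show ?case by simp
qed simp

lemma measurable_state [measurable]: "state \<in> \<mu> \<rightarrow>\<^sub>M count_space UNIV"
proof -
  have [measurable]: "Measurable.pred \<mu> (\<lambda>z. zero_run (fst z) n)" for n
    unfolding zero_run_def by measurable
  have "(\<lambda>z. LEAST n. zero_run (fst z) n) \<in> \<mu> \<rightarrow>\<^sub>M count_space UNIV"
    by (rule measurable_Least) measurable
  then have "(\<lambda>z. run (LEAST n. zero_run (fst z) n) None z) \<in> \<mu> \<rightarrow>\<^sub>M count_space UNIV"
    by (rule measurable_compose_countable[OF measurable_run])
  then show ?thesis
    by (simp add: state_def[abs_def])
qed

lemma measurable_code [measurable]: "Measurable.pred \<mu> code"
proof -
  have "Measurable.pred \<mu> (\<lambda>z. case q of None \<Rightarrow> False | Some c \<Rightarrow> V (canon c) \<longleftrightarrow> close c (snd z))" for q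
    by (cases q) (auto simp del: fun_Compl_def)
  then have "Measurable.pred \<mu> (\<lambda>z. case state z of None \<Rightarrow> False | Some c \<Rightarrow> V (canon c) \<longleftrightarrow> close c (snd z))"
    by (rule measurable_compose_countable[OF _ measurable_state])
  then show ?thesis
    by (simp add: code_def[abs_def])
qed

section \<open>Reconstruction of the state from finitely many labels\<close>

definition decode :: "nat list \<Rightarrow> nat list option" where
  "decode ls = foldr decode_step ls None"

lemma state_foldr:
  assumes "sync z"
  shows "state z = foldr decode_step (labels code n z) (state ((S ^^ n) z))"
proof (induction n)
  case (Suc n)
  have "state ((S ^^ n) z) = decode_step (flip_label code ((S ^^ n) z)) (state ((S ^^ Suc n) z))"
    using flip_label_code_state[OF sync_S_funpow[OF assms], of n] by simp
  then show ?case
    using Suc by (simp add: labels_def)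
qed (simp add: labels_def)

lemma valid_foldr:
  "set ls \<subseteq> {0, 1} \<Longrightarrow> valid_state N q \<Longrightarrow> valid_state N (foldr decode_step ls q)"
proof (induction ls)
  case (Cons l ls)
  then have l: "l \<in> {0, 1}" and IH: "valid_state N (foldr decode_step ls q)"
    by auto
  show ?case
    unfolding foldr.simps o_apply decode_step_def[of l]
  proof (rule valid_state_block_step[OF IH _ N_pos])
    show "(if V (canon c) then 1 - l else l) \<in> {0, 1}" for c
      using l by auto
  qed
qed simp

lemma remaining_foldr:
  "set ls \<subseteq> {0} \<Longrightarrow> remaining N (foldr decode_step ls q) \<le> remaining N q - length ls"
proof (induction ls)
  case (Cons l ls)
  then have l: "l = 0" and IH: "remaining N (foldr decode_step ls q) \<le> remaining N q - length ls"
    by auto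
  have "remaining N (foldr decode_step (l # ls) q) \<le> remaining N (foldr decode_step ls q) - 1"
    unfolding foldr.simps o_apply l decode_step_def[of 0] by (rule remaining_block_step)
  with IH show ?case by simp
qed simp

text \<open>\<open>V\<close> influences the decoded symbols but not the timing, so \<open>N\<close>
  zero labels end any block and start none.\<close>

lemma foldr_zeros:
  assumes "valid_state N q"
  shows "foldr decode_step (replicate N 0) q = None"
proof (rule remaining_0)
  show "valid_state N (foldr decode_step (replicate N 0) q)"
    using assms by (intro valid_foldr) auto
  show "remaining N (foldr decode_step (replicate N 0) q) = 0"
    using remaining_foldr[of "replicate N 0" q] remaining_le[of N q] by (auto simp: set_replicate_conv_if)
qed

lemma labels_bits:
  assumes "z \<in> space \<mu>"
  shows "set (labels f n z) \<subseteq> {0, 1}"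
proof
  fix l assume "l \<in> set (labels f n z)"
  then obtain i where "l = flip_label f ((S ^^ i) z)"
    by (auto simp: labels_def)
  then show "l \<in> {0, 1}"
    using flip_label_bit[OF symbols.S_funpow_space[OF assms]] by simp
qed

lemma labels_add: "labels f (n + k) z = labels f n z @ labels f k ((S ^^ n) z)"
proof -
  have "map g [n..<n + k] = map (\<lambda>i. g (n + i)) [0..<k]" for g :: "nat \<Rightarrow> nat"
    by (rule nth_equalityI) auto
  then show ?thesis
    unfolding labels_def upt_add_eq_append[OF le0] map_append
    by (simp add: funpow_add add.commute[of n])
qed

text \<open>The \<open>N\<close> zero labels erase the initial value of the fold. Decoding from
  \<open>None\<close> therefore agrees with decoding from the true state at
  \<open>(S ^^ n) z\<close>, and \<open>state_foldr\<close> applies.\<close>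

lemma decode_eq_state:
  assumes z: "sync z" and i: "i + N \<le> n" "\<And>j. j < N \<Longrightarrow> flip_label code ((S ^^ (i + j)) z) = 0"
  shows "decode (labels code n z) = state z"
proof -
  define w where "w = (S ^^ i) z"
  define v where "v = (S ^^ N) w"
  have w: "sync w" "sync v"
    using z by (simp_all add: w_def v_def sync_S_funpow)
  have "labels code N w = replicate N 0"
    by (rule nth_equalityI) (use i(2) in \<open>auto simp: labels_def w_def funpow_add add.commute[of i]\<close>)
  moreover have "n = i + (N + (n - i - N))"
    using i by simp
  ultimately have split: "labels code n z = labels code i z @ replicate N 0 @ labels code (n - i - N) v"
    using labels_add[of code i "N + (n - i - N)" z] labels_add[of code N "n - i - N" w]
    by (simp add: w_def v_def)
  have "foldr decode_step (labels code n z) q = foldr decode_step (labels code i z) None"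
    if "valid_state N q" for q
  proof -
    have "valid_state N (foldr decode_step (labels code (n - i - N) v) q)"
      using w that by (intro valid_foldr labels_bits sync_space)
    then show ?thesis
      by (simp only: split foldr_append foldr_zeros)
  qed
  then have "foldr decode_step (labels code n z) None = foldr decode_step (labels code n z) (state ((S ^^ n) z))"
    using valid_state[OF symbols.S_funpow_space[OF sync_space[OF z]]] by simp
  then show ?thesis
    using state_foldr[OF z, of n] by (simp add: decode_def)
qed

text \<open>A run of ones between positions \<open>L\<close> and \<open>L + K\<close> brings the two
  points together, and they stay together down to index 0, in particular on the first
  \<open>L\<close> coordinates.\<close>

lemma coupled:
  assumes z: "sync z" "state z = Some c" and len: "L + K \<le> length c"
    and i: "i + R \<le> K" "\<And>j. j < R \<Longrightarrow> fst z (L + i + j) = 1"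
    and hit: "\<forall>n s. \<exists>k\<le>R. dist (snd ((S ^^ n) z)) ((T ^^ (s + k)) p) < d"
  shows "close c (snd z)" "n < L \<Longrightarrow> c ! n = fst z n"
proof -
  have "close (drop (L + i) c) (snd ((S ^^ (L + i)) z))"
    by (rule close_after_ones[OF z, where R = R]) (use len i hit in \<open>auto simp: add.assoc\<close>)
  then have *: "close (drop k c) (snd ((S ^^ k) z))" if "k \<le> L" for k
    using close_drop_mono[OF z, of "L + i" k] len i(1) that by simp
  show "close c (snd z)"
    using *[of 0] by simp
  show "c ! n = fst z n" if "n < L"
    using state_nth[OF z, of n] *[of "Suc n"] that len by simp
qed

section \<open>Measure of the phases of a block\<close>

definition length_set :: "nat \<Rightarrow> ((nat \<Rightarrow> nat) \<times> 'y) set" where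
  "length_set j = {z \<in> space \<mu>. \<exists>c. state z = Some c \<and> length c = j}"

lemma sets_state: "{z \<in> space \<mu>. P (state z)} \<in> sets \<mu>"
proof -
  have "state -` {q. P q} \<inter> space \<mu> \<in> sets \<mu>"
    by (rule measurable_sets[OF measurable_state]) simp
  moreover have "state -` {q. P q} \<inter> space \<mu> = {z \<in> space \<mu>. P (state z)}"
    by auto
  ultimately show ?thesis by simp
qed

lemma sets_state_S: "{z \<in> space \<mu>. P (state (S z))} \<in> sets \<mu>"
proof -
  have "(\<lambda>z. state (S z)) -` {q. P q} \<inter> space \<mu> \<in> sets \<mu>"
    by (rule measurable_sets[OF measurable_compose[OF measurable_S measurable_state]]) simp
  moreover have "(\<lambda>z. state (S z)) -` {q. P q} \<inter> space \<mu> = {z \<in> space \<mu>. P (state (S z))}"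
    by auto
  ultimately show ?thesis by simp
qed

lemma sets_length_set [measurable]: "length_set j \<in> sets \<mu>"
  unfolding length_set_def by (rule sets_state)

text \<open>A block that has not reached its full length always continues, so up to a null set
  \<open>length_set (Suc j)\<close> is the preimage of \<open>length_set j\<close> under
  \<open>S\<close>.\<close>

lemma measure_length_set_Suc:
  assumes "Suc j < N"
  shows "measure \<mu> (length_set (Suc j)) = measure \<mu> (length_set j)"
proof -
  let ?A = "{z \<in> space \<mu>. \<exists>c. state (S z) = Some c \<and> length c = j}"
  have "AE z in \<mu>. z \<in> length_set (Suc j) \<longleftrightarrow> z \<in> ?A"
    using AE_sync
  proof eventually_elim
    fix z assume z: "sync z"
    have "(\<exists>c. state z = Some c \<and> length c = Suc j) \<longleftrightarrow> (\<exists>c. state (S z) = Some c \<and> length c = j)"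
    proof
      assume "\<exists>c. state z = Some c \<and> length c = Suc j"
      then obtain a c where "state z = Some (a # c)" "length c = j"
        by (metis length_Suc_conv)
      then show "\<exists>c. state (S z) = Some c \<and> length c = j"
        using state_Cons[OF z] by blast
    next
      assume "\<exists>c. state (S z) = Some c \<and> length c = j"
      then obtain c where c: "state (S z) = Some c" "length c = j"
        by blast
      then show "\<exists>c. state z = Some c \<and> length c = Suc j"
        using state_Cons[OF z] assms by (metis length_Cons)
    qed
    then show "z \<in> length_set (Suc j) \<longleftrightarrow> z \<in> ?A"
      by (simp add: length_set_def)
  qed
  then have "measure \<mu> (length_set (Suc j)) = measure \<mu> ?A"
    using sets_length_set sets_state_S by (rule measure_eq_AE)
  also have "\<dots> = measure \<mu> (length_set j)"
    using symbols.prob_S_funpow[of "\<lambda>z. \<exists>c. state z = Some c \<and> length c = j" 1] sets_state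
    by (simp add: length_set_def)
  finally show ?thesis .
qed

lemma measure_length_set: "j < N \<Longrightarrow> measure \<mu> (length_set j) = measure \<mu> (length_set 0)"
  by (induction j) (auto simp: measure_length_set_Suc)

text \<open>A waiting automaton starts a block with probability 1/2, as the next symbol read is fair
  and independent of \<open>S z\<close>.\<close>

lemma measure_idle: "measure \<mu> {z \<in> space \<mu>. state z = None} = 2 * measure \<mu> (length_set 0)"
proof -
  let ?I = "{z \<in> space \<mu>. state z = None}"
  have I: "?I \<in> sets \<mu>"
    by (rule sets_state)
  let ?A = "{z \<in> space \<mu>. fst z 0 = 1 \<and> S z \<in> ?I}"
  have A: "?A \<in> sets \<mu>"
    using I by measurable
  have "AE z in \<mu>. z \<in> length_set 0 \<longleftrightarrow> z \<in> ?A"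
    using AE_sync
    by eventually_elim (auto simp: length_set_def state_Nil S_in_space)
  then have "measure \<mu> (length_set 0) = measure \<mu> ?A"
    using sets_length_set A by (rule measure_eq_AE)
  also have "\<dots> = measure \<mu> ?I / 2"
    using fair_symbol[of 1, OF _ I] by (simp add: coin_m.emeasure_eq_measure ennreal_divide_numeral)
  finally show ?thesis by simp
qed

text \<open>The \<open>N\<close> disjoint sets \<open>length_set j\<close> have a common measure
  \<open>?a\<close>, hence \<open>N * ?a\<close> is at most 1. Waiting contributes
  \<open>2 * ?a\<close> and the lengths below \<open>J\<close> contribute
  \<open>J * ?a\<close>.\<close>

lemma measure_short:
  assumes "J \<le> N"
  shows "measure \<mu> {z \<in> space \<mu>. \<forall>c. state z = Some c \<longrightarrow> length c < J} \<le> real (J + 2) / real N"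
proof -
  let ?a = "measure \<mu> (length_set 0)"
  have sum_eq: "(\<Sum>j<n. measure \<mu> (length_set j)) = real n * ?a" if "n \<le> N" for n
  proof -
    have "(\<Sum>j<n. measure \<mu> (length_set j)) = (\<Sum>j<n. ?a)"
      by (intro sum.cong refl measure_length_set) (use that in auto)
    then show ?thesis by simp
  qed
  have "real N * ?a = (\<Sum>j<N. measure \<mu> (length_set j))"
    by (rule sum_eq[symmetric]) simp
  also have "\<dots> = measure \<mu> (\<Union>j<N. length_set j)"
    by (rule coin_m.finite_measure_finite_Union[symmetric])
      (auto simp: disjoint_family_on_def length_set_def intro!: sets_state)
  also have "\<dots> \<le> 1"
    by simp
  finally have a: "?a \<le> 1 / real N"
    using N_pos by (simp add: field_simps)
  have "{z \<in> space \<mu>. \<forall>c. state z = Some c \<longrightarrow> length c < J} \<subseteq>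
      {z \<in> space \<mu>. state z = None} \<union> (\<Union>j<J. length_set j)"
  proof
    fix z assume z: "z \<in> {z \<in> space \<mu>. \<forall>c. state z = Some c \<longrightarrow> length c < J}"
    then show "z \<in> {z \<in> space \<mu>. state z = None} \<union> (\<Union>j<J. length_set j)"
      by (cases "state z") (simp_all add: length_set_def)
  qed
  then have "measure \<mu> {z \<in> space \<mu>. \<forall>c. state z = Some c \<longrightarrow> length c < J} \<le>
      measure \<mu> ({z \<in> space \<mu>. state z = None} \<union> (\<Union>j<J. length_set j))"
    by (rule coin_m.finite_measure_mono) (intro sets.Un sets_state sets.finite_UN, auto)
  also have "\<dots> \<le> measure \<mu> {z \<in> space \<mu>. state z = None} + measure \<mu> (\<Union>j<J. length_set j)"
    by (rule measure_Un_le) (intro sets_state sets.finite_UN, auto)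
  also have "measure \<mu> (\<Union>j<J. length_set j) \<le> (\<Sum>j<J. measure \<mu> (length_set j))"
    by (rule coin_m.finite_measure_subadditive_finite) auto
  also have "\<dots> = real J * ?a"
    by (rule sum_eq[OF assms])
  also have "measure \<mu> {z \<in> space \<mu>. state z = None} + real J * ?a = real (J + 2) * ?a"
    by (simp add: measure_idle algebra_simps)
  also have "\<dots> \<le> real (J + 2) * (1 / real N)"
    using a by (rule mult_left_mono) simp
  finally show ?thesis by simp
qed

end

lemma measurable_map_upt:
  fixes h :: "nat \<Rightarrow> 'a \<Rightarrow> nat"
  assumes "\<And>i. h i \<in> M \<rightarrow>\<^sub>M count_space UNIV"
  shows "(\<lambda>z. map (\<lambda>i. h i z) [0..<n]) \<in> M \<rightarrow>\<^sub>M count_space UNIV"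
proof (induction n)
  case (Suc n)
  have "(\<lambda>z. ls @ [h n z]) \<in> M \<rightarrow>\<^sub>M count_space UNIV" for ls
    by (rule measurable_compose[OF assms]) simp
  then have "(\<lambda>z. map (\<lambda>i. h i z) [0..<n] @ [h n z]) \<in> M \<rightarrow>\<^sub>M count_space UNIV"
    by (rule measurable_compose_countable[OF _ Suc])
  then show ?case by simp
qed simp

context ergodic_isometry begin

subsection \<open>Recovering a point from finitely many labels\<close>

text \<open>The decoder \<open>D\<close> guesses only the first symbol and the point of
  \<open>Y\<close>; further symbols are found by decoding along the orbit.\<close>

abbreviation unrecovered :: "real \<Rightarrow> ((nat \<Rightarrow> nat) \<times> 'y \<Rightarrow> bool) \<Rightarrow> nat \<Rightarrow> (nat list \<Rightarrow> nat \<times> 'y) \<Rightarrow>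
    ((nat \<Rightarrow> nat) \<times> 'y) set" where
  "unrecovered e f n D \<equiv> {z \<in> space \<mu>.
     \<not> (fst (D (labels f n z)) = fst z 0 \<and> dist (snd z) (snd (D (labels f n z))) < e)}"

definition recovers :: "real \<Rightarrow> ((nat \<Rightarrow> nat) \<times> 'y \<Rightarrow> bool) \<Rightarrow> nat \<Rightarrow> (nat list \<Rightarrow> nat \<times> 'y) \<Rightarrow> bool" where
  "recovers e f n D \<longleftrightarrow> measure \<mu> (unrecovered e f n D) < e"

lemma measurable_labels:
  assumes "Measurable.pred \<mu> f"
  shows "labels f n \<in> \<mu> \<rightarrow>\<^sub>M count_space UNIV"
  unfolding labels_def[abs_def]
  by (rule measurable_map_upt)
    (rule measurable_compose[OF symbols.measurable_S_funpow measurable_flip_label[OF assms]])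

lemma sets_unrecovered:
  assumes "Measurable.pred \<mu> f"
  shows "unrecovered e f n D \<in> sets \<mu>"
proof -
  have "Measurable.pred \<mu> (\<lambda>z. \<not> (fst (D ls) = fst z 0 \<and> dist (snd z) (snd (D ls)) < e))" for ls
  proof -
    have [measurable]: "(\<lambda>z. dist (snd z) (snd (D ls))) \<in> borel_measurable \<mu>"
      by (rule measurable_compose[OF measurable_snd borel_measurable_dist_m])
    show ?thesis by measurable
  qed
  then have "Measurable.pred \<mu> (\<lambda>z. \<not> (fst (D (labels f n z)) = fst z 0 \<and> dist (snd z) (snd (D (labels f n z))) < e))"
    by (rule measurable_compose_countable[OF _ measurable_labels[OF assms]])
  then show ?thesis
    by simp
qed

text \<open>The new rule is the code of a block construction. Its parameters are chosen in the order
  \<open>L\<close>, \<open>R\<close>, \<open>K\<close>, \<open>N\<close>, \<open>n\<close>, each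
  depending on earlier ones.\<close>

lemma recovers_dense:
  assumes f [measurable]: "Measurable.pred \<mu> f" and e: "0 < e"
  shows "\<exists>g n D. Measurable.pred \<mu> g \<and> measure \<mu> {z \<in> space \<mu>. f z \<noteq> g z} < e \<and>
    (\<forall>ls. snd (D ls) \<in> Y) \<and> recovers e g n D"
proof -
  have e8: "0 < e / 8" using e by simp
  have "{z \<in> space \<mu>. f z} \<in> sets \<mu>"
    by measurable
  from almost_locally_constantD[OF almost_locally_constant_measurable[OF this] e8]
  obtain L d0 G where d0: "0 < d0" and G: "G \<in> sets \<mu>" "measure \<mu> (space \<mu> - G) < e / 8"
    and G_const: "\<forall>z\<in>G. \<forall>w\<in>G. agree L d0 z w \<longrightarrow> (z \<in> {z \<in> space \<mu>. f z} \<longleftrightarrow> w \<in> {z \<in> space \<mu>. f z})"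
    by (elim exE conjE)
  \<comment> \<open>\<open>d0 / 2\<close>, because two points of \<open>G\<close> are compared
    through a third one within \<open>d\<close> of both; \<open>e\<close>, because \<open>d\<close>
    also bounds the error of the decoded position.\<close>
  define d where "d = min (d0 / 2) e"
  have d: "0 < d" "2 * d \<le> d0" "d \<le> e"
    using d0 e by (auto simp: d_def)
  \<comment> \<open>\<open>V\<close> extends \<open>f\<close> from \<open>G\<close> to nearby
    canonical points; \<open>G_const\<close> makes the choice of the witness in \<open>G\<close>
    immaterial.\<close>
  define V where "V z' \<longleftrightarrow> (\<exists>z\<in>G. f z \<and> agree L d z z')" for z'
  have V: "V z' \<longleftrightarrow> f w" if w: "w \<in> G" "agree L d w z'" for w z'
  proof
    assume "V z'"
    then obtain z where z: "z \<in> G" "f z" "agree L d z z'"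
      by (auto simp: V_def)
    have "dist (snd z) (snd w) \<le> dist (snd z) (snd z') + dist (snd w) (snd z')"
      by (rule dist_triangle2)
    then have "agree L d0 z w"
      using z(3) w(2) d by (auto simp: agree_def)
    moreover have "z \<in> space \<mu>" "w \<in> space \<mu>"
      using subsetD[OF sets.sets_into_space[OF G(1)]] z w by auto
    ultimately show "f w"
      using G_const z w by auto
  qed (use w in \<open>auto simp: V_def\<close>)
  obtain p R where p: "p \<in> Y" and hit: "AE y in m. \<forall>s. \<exists>k\<le>R. dist y ((T ^^ (s + k)) p) < d"
    using uniform_hitting[OF d(1)] by blast
  obtain K where K: "measure \<mu> {z \<in> space \<mu>. \<not> (\<exists>i. i + R \<le> K \<and> (\<forall>j<R. fst ((S ^^ (i + j)) z) 0 = 1))} < e / 8"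
    using symbols.run_likely[of 1 "e / 8" R] e8 by auto
  \<comment> \<open>\<open>Suc L\<close> ensures that symbol 0 is coupled even if
    \<open>L = 0\<close>.\<close>
  define J where "J = Suc L + K"
  define N where "N = J + nat \<lceil>8 * real (J + 2) / e\<rceil> + 1"
  have N: "0 < N" "J \<le> N" "real (J + 2) / real N < e / 8"
  proof -
    show "0 < N" "J \<le> N" by (simp_all add: N_def)
    have "8 * real (J + 2) / e < real N"
      unfolding N_def by linarith
    then show "real (J + 2) / real N < e / 8"
      using e \<open>0 < N\<close> by (simp add: field_simps)
  qed
  interpret B: block_code Y m T N d p V
    using N(1) p by unfold_locales
  interpret F: fair_label \<mu> S "flip_label B.code"
    by (rule fair_label_flip_label[OF B.measurable_code])
  obtain n where n: "measure \<mu> {z \<in> space \<mu>. \<not> (\<exists>i. i + N \<le> n \<and> (\<forall>j<N. flip_label B.code ((S ^^ (i + j)) z) = 0))} < e / 8"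
    using F.run_likely[of 0 "e / 8" N] e8 by auto
  \<comment> \<open>The most recent canonical symbol and position stand in for those of
    \<open>z\<close>. The default for \<open>None\<close> merely keeps the guess in
    \<open>Y\<close>.\<close>
  define D where "D ls = (case B.decode ls of None \<Rightarrow> (0, p) | Some c \<Rightarrow> (hd c, snd (B.canon c)))" for ls
  \<comment> \<open>The four ways to fail: waiting or too early in a block, no run of ones in time,
    outside \<open>G\<close>, no resetting run of zero labels.\<close>
  define B1 where "B1 = {z \<in> space \<mu>. \<forall>c. B.state z = Some c \<longrightarrow> length c < J}"
  define B2 where "B2 = {z \<in> space \<mu>. \<not> (\<exists>i. i + R \<le> K \<and> (\<forall>j<R. fst ((S ^^ (i + j)) ((S ^^ Suc L) z)) 0 = 1))}"
  define B3 where "B3 = space \<mu> - G"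
  define B4 where "B4 = {z \<in> space \<mu>. \<not> (\<exists>i. i + N \<le> n \<and> (\<forall>j<N. flip_label B.code ((S ^^ (i + j)) z) = 0))}"
  have K_sets: "{z \<in> space \<mu>. \<not> (\<exists>i. i + R \<le> K \<and> (\<forall>j<R. fst ((S ^^ (i + j)) z) 0 = 1))} \<in> sets \<mu>"
    by (rule symbols.sets_no_run_within)
  have B1: "B1 \<in> sets \<mu>" "measure \<mu> B1 < e / 8"
    unfolding B1_def by (rule B.sets_state) (rule le_less_trans[OF B.measure_short[OF N(2)] N(3)])
  have B2: "B2 \<in> sets \<mu>" "measure \<mu> B2 < e / 8"
  proof -
    have "B2 = (S ^^ Suc L) -` {z \<in> space \<mu>. \<not> (\<exists>i. i + R \<le> K \<and> (\<forall>j<R. fst ((S ^^ (i + j)) z) 0 = 1))} \<inter> space \<mu>"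
      using symbols.S_funpow_space[of _ "Suc L"] by (auto simp: B2_def)
    then show "B2 \<in> sets \<mu>"
      using measurable_sets[OF symbols.measurable_S_funpow K_sets] by simp
    have "measure \<mu> B2 = measure \<mu> {z \<in> space \<mu>. \<not> (\<exists>i. i + R \<le> K \<and> (\<forall>j<R. fst ((S ^^ (i + j)) z) 0 = 1))}"
      unfolding B2_def by (rule symbols.prob_S_funpow[OF K_sets])
    then show "measure \<mu> B2 < e / 8"
      using K by (rule ord_eq_less_trans)
  qed
  have B3: "B3 \<in> sets \<mu>" "measure \<mu> B3 < e / 8"
    using G by (auto simp: B3_def)
  have B4: "B4 \<in> sets \<mu>" "measure \<mu> B4 < e / 8"
    unfolding B4_def by (rule F.sets_no_run_within) (rule n)
  define W where "W = (B1 \<union> B2) \<union> (B3 \<union> B4)"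
  have W: "W \<in> sets \<mu>"
    using B1 B2 B3 B4 by (simp add: W_def)
  have "measure \<mu> W \<le> measure \<mu> (B1 \<union> B2) + measure \<mu> (B3 \<union> B4)"
    unfolding W_def using B1 B2 B3 B4 by (intro measure_Un_le) auto
  also have "\<dots> \<le> (measure \<mu> B1 + measure \<mu> B2) + (measure \<mu> B3 + measure \<mu> B4)"
    using B1 B2 B3 B4 by (intro add_mono measure_Un_le) auto
  also have "\<dots> < e"
    using B1 B2 B3 B4 e by linarith
  finally have W_meas: "measure \<mu> W < e" .
  have "AE z in \<mu>. \<forall>n s. \<exists>k\<le>R. dist (snd ((S ^^ n) z)) ((T ^^ (s + k)) p) < d"
    by (rule symbols.AE_S_funpow[OF AE_snd[OF hit]])
  with B.AE_sync have good: "AE z in \<mu>. z \<notin> W \<longrightarrow> (f z \<longleftrightarrow> B.code z) \<and>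
      fst (D (labels B.code n z)) = fst z 0 \<and> dist (snd z) (snd (D (labels B.code n z))) < e"
  proof eventually_elim
    fix z assume sync: "B.sync z"
      and hit: "\<forall>n s. \<exists>k\<le>R. dist (snd ((S ^^ n) z)) ((T ^^ (s + k)) p) < d"
    show "z \<notin> W \<longrightarrow> (f z \<longleftrightarrow> B.code z) \<and>
      fst (D (labels B.code n z)) = fst z 0 \<and> dist (snd z) (snd (D (labels B.code n z))) < e"
    proof
      assume "z \<notin> W"
      then have z: "z \<notin> B1" "z \<notin> B2" "z \<in> G" "z \<notin> B4" "z \<in> space \<mu>"
        using B.sync_space[OF sync] by (auto simp: W_def B3_def)
      obtain c where c: "B.state z = Some c" "Suc L + K \<le> length c"
        using z(1,5) unfolding B1_def J_def by force
      obtain i where i: "i + R \<le> K" "\<And>j. j < R \<Longrightarrow> fst z (Suc L + i + j) = 1"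
        using z(2,5) unfolding B2_def by (auto simp: fst_S_funpow fst_S left_shift_def add.assoc)
      note coupled = B.coupled[OF sync c i hit]
      have "agree L d z (B.canon c)"
        using coupled c(2) by (auto simp: agree_def B.close_def B.canon_def)
      then have "f z \<longleftrightarrow> B.code z"
        using V[OF z(3)] coupled(1) c(1) by (simp add: B.code_def)
      moreover obtain i where "i + N \<le> n" "\<And>j. j < N \<Longrightarrow> flip_label B.code ((S ^^ (i + j)) z) = 0"
        using z(4,5) unfolding B4_def by blast
      then have "B.decode (labels B.code n z) = Some c"
        using B.decode_eq_state[OF sync] c(1) by simp
      then have D: "D (labels B.code n z) = (hd c, snd (B.canon c))"
        by (simp add: D_def)
      have "hd c = fst z 0"
        using coupled(2)[of 0] c(2) by (cases c) auto
      moreover have "dist (snd z) (snd (B.canon c)) < e"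
        using coupled(1) d(3) by (simp add: B.close_def)
      ultimately show "(f z \<longleftrightarrow> B.code z) \<and>
        fst (D (labels B.code n z)) = fst z 0 \<and> dist (snd z) (snd (D (labels B.code n z))) < e"
        by (simp add: D)
    qed
  qed
  have "measure \<mu> {z \<in> space \<mu>. f z \<noteq> B.code z} \<le> measure \<mu> W"
    by (rule coin_m.finite_measure_mono_AE[OF _ W]) (use good in eventually_elim, auto)
  moreover have "measure \<mu> (unrecovered e B.code n D) \<le> measure \<mu> W"
    by (rule coin_m.finite_measure_mono_AE[OF _ W]) (use good in eventually_elim, auto)
  moreover have "snd (D ls) \<in> Y" for ls
    by (auto simp: D_def B.canon_def T_funpow_in_Y p split: option.split)
  ultimately show ?thesis
    using W_meas B.measurable_code unfolding recovers_def
    by (intro exI[of _ B.code] exI[of _ n] exI[of _ D]) auto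
qed

lemma sets_differ:
  assumes [measurable]: "Measurable.pred \<mu> f" "Measurable.pred \<mu> g"
  shows "{z \<in> space \<mu>. f z \<noteq> g z} \<in> sets \<mu>"
  by measurable

text \<open>The first \<open>n\<close> labels consult the rule only at the \<open>n\<close> points
  \<open>(S ^^ Suc i) z\<close>, each distributed like \<open>z\<close>. This is the openness of
  recovery.\<close>

lemma measure_unrecovered_perturb:
  assumes f: "Measurable.pred \<mu> f" and g: "Measurable.pred \<mu> g"
  shows "measure \<mu> (unrecovered e f n D) \<le> measure \<mu> (unrecovered e g n D) + n * measure \<mu> {z \<in> space \<mu>. f z \<noteq> g z}"
proof -
  define A where "A i = {z \<in> space \<mu>. f ((S ^^ Suc i) z) \<noteq> g ((S ^^ Suc i) z)}" for i
  have A_measure: "measure \<mu> (A i) = measure \<mu> {z \<in> space \<mu>. f z \<noteq> g z}" for i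
    unfolding A_def by (rule symbols.prob_S_funpow[OF sets_differ[OF f g]])
  have A: "A i \<in> sets \<mu>" for i
    unfolding A_def using measurable_compose[OF symbols.measurable_S_funpow f] measurable_compose[OF symbols.measurable_S_funpow g]
    by (rule sets_differ)
  have sub: "unrecovered e f n D \<subseteq> unrecovered e g n D \<union> (\<Union>i<n. A i)"
  proof
    fix z assume z: "z \<in> unrecovered e f n D"
    show "z \<in> unrecovered e g n D \<union> (\<Union>i<n. A i)"
    proof (cases "\<exists>i<n. z \<in> A i")
      case False
      then have "labels f n z = labels g n z"
        using z by (auto simp: labels_def A_def flip_label_def)
      then show ?thesis
        using z by simp
    qed auto
  qed
  have "measure \<mu> (unrecovered e f n D) \<le> measure \<mu> (unrecovered e g n D \<union> (\<Union>i<n. A i))"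
    by (rule coin_m.finite_measure_mono[OF sub])
      (intro sets.Un sets_unrecovered[OF g] sets.finite_UN A, simp)
  also have "\<dots> \<le> measure \<mu> (unrecovered e g n D) + measure \<mu> (\<Union>i<n. A i)"
    by (intro measure_Un_le sets_unrecovered[OF g] sets.finite_UN A) simp
  also have "measure \<mu> (\<Union>i<n. A i) \<le> (\<Sum>i<n. measure \<mu> (A i))"
    using A by (intro coin_m.finite_measure_subadditive_finite) auto
  also have "\<dots> = n * measure \<mu> {z \<in> space \<mu>. f z \<noteq> g z}"
    by (simp add: A_measure)
  finally show ?thesis by simp
qed

lemma recovers_mono:
  assumes "recovers e f n D" "e \<le> e'" "Measurable.pred \<mu> f"
  shows "recovers e' f n D"
proof -
  have "measure \<mu> (unrecovered e' f n D) \<le> measure \<mu> (unrecovered e f n D)"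
    by (rule coin_m.finite_measure_mono[OF _ sets_unrecovered[OF assms(3)]]) (use assms(2) in auto)
  also have "\<dots> < e"
    using assms(1) by (simp only: recovers_def)
  also have "e \<le> e'"
    by (rule assms(2))
  finally show ?thesis
    by (simp only: recovers_def)
qed

lemma exists_recovering_code:
  "\<exists>f n D. Measurable.pred \<mu> f \<and> (\<forall>k ls. snd (D k ls) \<in> Y) \<and>
    (\<forall>k. measure \<mu> (unrecovered ((1 / 2) ^ k) f (n k) (D k)) \<le> 2 * (1 / 2) ^ k)"
proof -
  define P where "P k x \<longleftrightarrow> (case x of (g, n, D, b) \<Rightarrow> Measurable.pred \<mu> g \<and> (\<forall>ls. snd (D ls) \<in> Y) \<and>
      recovers ((1 / 2) ^ k) g n D \<and> 0 < b \<and> 2 * real n * b \<le> (1 / 2) ^ k)"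
    for k and x :: "((nat \<Rightarrow> nat) \<times> 'y \<Rightarrow> bool) \<times> nat \<times> (nat list \<Rightarrow> nat \<times> 'y) \<times> real"
  define Q where "Q x x' \<longleftrightarrow> (case x of (g, n, D, b) \<Rightarrow> case x' of (g', n', D', b') \<Rightarrow>
      measure \<mu> {z \<in> space \<mu>. g z \<noteq> g' z} < b \<and> b' \<le> b / 2)"
    for x x' :: "((nat \<Rightarrow> nat) \<times> 'y \<Rightarrow> bool) \<times> nat \<times> (nat list \<Rightarrow> nat \<times> 'y) \<times> real"
  have step: "\<exists>x. P k x \<and> Q (f, n0, D0, e) x" if f: "Measurable.pred \<mu> f" and e: "0 < e" for f e k n0 D0
  proof -
    have "0 < min e ((1 / 2) ^ k)"
      using e by simp
    from recovers_dense[OF f this]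
    obtain g n D where g: "Measurable.pred \<mu> g" "measure \<mu> {z \<in> space \<mu>. f z \<noteq> g z} < min e ((1 / 2) ^ k)"
      "\<forall>ls. snd (D ls) \<in> Y" "recovers (min e ((1 / 2) ^ k)) g n D"
      by (elim exE conjE)
    \<comment> \<open>The \<open>+ 1\<close> avoids a zero denominator when
      \<open>n = 0\<close>.\<close>
    define b where "b = min (e / 2) ((1 / 2) ^ k / (2 * (real n + 1)))"
    have "2 * real n * b \<le> 2 * real n * ((1 / 2) ^ k / (2 * (real n + 1)))"
      unfolding b_def by (intro mult_left_mono) auto
    also have "\<dots> \<le> (1 / 2) ^ k"
      by (simp add: divide_simps)
    finally have "2 * real n * b \<le> (1 / 2) ^ k" .
    moreover have "0 < b"
      using e by (simp add: b_def)
    moreover have "b \<le> e / 2"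
      unfolding b_def by (rule min.cobounded1)
    moreover have "recovers ((1 / 2) ^ k) g n D"
      using recovers_mono[OF g(4) _ g(1)] by simp
    ultimately show ?thesis
      using g by (intro exI[of _ "(g, n, D, b)"]) (simp add: P_def Q_def)
  qed
  have "\<exists>x. \<forall>k. P k (x k) \<and> Q (x k) (x (Suc k))"
  proof (rule dependent_nat_choice)
    show "\<exists>x. P 0 x"
      using step[of "\<lambda>_. False" 1 0 0 "\<lambda>_. undefined"] by auto
    show "\<exists>x'. P (Suc k) x' \<and> Q x x'" if "P k x" for x k
    proof -
      obtain g n D b where x: "x = (g, n, D, b)" by (cases x)
      then show ?thesis
        using that step[of g b "Suc k" n D] by (simp add: P_def)
    qed
  qed
  then obtain x where x: "\<And>k. P k (x k)" "\<And>k. Q (x k) (x (Suc k))"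
    by blast
  define g where "g k = fst (x k)" for k
  define n where "n k = fst (snd (x k))" for k
  define D where "D k = fst (snd (snd (x k)))" for k
  define b where "b k = snd (snd (snd (x k)))" for k
  have g: "Measurable.pred \<mu> (g k)" and D: "snd (D k ls) \<in> Y"
    and rec: "recovers ((1 / 2) ^ k) (g k) (n k) (D k)"
    and b: "0 < b k" "2 * real (n k) * b k \<le> (1 / 2) ^ k" for k ls
    using x(1)[of k] by (auto simp: P_def g_def n_def D_def b_def split: prod.splits)
  have g_step: "measure \<mu> {z \<in> space \<mu>. g k z \<noteq> g (Suc k) z} < b k" and b_Suc: "b (Suc k) \<le> b k / 2" for k
    using x(2)[of k] by (auto simp: Q_def g_def b_def split: prod.splits)
  have b_add: "b (k + i) \<le> b k * (1 / 2) ^ i" for k i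
  proof (induction i)
    case (Suc i)
    have "b (k + Suc i) \<le> b (k + i) / 2"
      using b_Suc[of "k + i"] by simp
    with Suc show ?case by simp
  qed simp
  \<comment> \<open>The pointwise limit inferior; it agrees with \<open>g k\<close> wherever no
    change occurs from stage \<open>k\<close> on.\<close>
  define f where "f z \<longleftrightarrow> (\<exists>k. \<forall>i\<ge>k. g i z)" for z
  have f: "Measurable.pred \<mu> f"
  proof -
    note [measurable] = g
    show ?thesis unfolding f_def[abs_def] by measurable
  qed
  have f_g: "measure \<mu> {z \<in> space \<mu>. f z \<noteq> g k z} \<le> 2 * b k" for k
  proof -
    define E where "E i = {z \<in> space \<mu>. g (k + i) z \<noteq> g (Suc (k + i)) z}" for i
    have E: "E i \<in> sets \<mu>" for i
      unfolding E_def by (rule sets_differ[OF g g])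
    have E_le: "measure \<mu> (E i) \<le> b k * (1 / 2) ^ i" for i
      using g_step[of "k + i"] b_add[of k i] by (simp add: E_def)
    have geo: "(\<lambda>i. b k * (1 / 2) ^ i) sums (b k * 2)"
      using sums_mult[OF geometric_sums[of "1 / 2 :: real"], of "b k"] by simp
    have summ: "summable (\<lambda>i. measure \<mu> (E i))"
      by (rule summable_comparison_test'[OF sums_summable[OF geo], of 0]) (use E_le in simp)
    have "{z \<in> space \<mu>. f z \<noteq> g k z} \<subseteq> (\<Union>i. E i)"
    proof
      fix z assume z: "z \<in> {z \<in> space \<mu>. f z \<noteq> g k z}"
      show "z \<in> (\<Union>i. E i)"
      proof (rule ccontr)
        assume "z \<notin> (\<Union>i. E i)"
        then have eq: "g (k + i) z = g (Suc (k + i)) z" for i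
          using z by (auto simp: E_def)
        have const: "g (k + i) z = g k z" for i
          by (induction i) (use eq in auto)
        have "f z \<longleftrightarrow> g k z"
        proof
          assume "f z"
          then obtain k' where "\<And>i. k' \<le> i \<Longrightarrow> g i z"
            by (auto simp: f_def)
          from this[of "k + k'"] show "g k z"
            using const[of k'] by simp
        next
          assume "g k z"
          then have "g i z" if "k \<le> i" for i
            using const[of "i - k"] that by simp
          then show "f z"
            by (auto simp: f_def)
        qed
        then show False
          using z by simp
      qed
    qed
    then have "measure \<mu> {z \<in> space \<mu>. f z \<noteq> g k z} \<le> measure \<mu> (\<Union>i. E i)"
      using E by (intro coin_m.finite_measure_mono) auto
    also have "\<dots> \<le> (\<Sum>i. measure \<mu> (E i))"
      using E summ by (intro coin_m.finite_measure_subadditive_countably) auto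
    also have "\<dots> \<le> (\<Sum>i. b k * (1 / 2) ^ i)"
      by (rule suminf_le[OF E_le summ sums_summable[OF geo]])
    also have "\<dots> = 2 * b k"
      using sums_unique[OF geo] by simp
    finally show ?thesis .
  qed
  have "measure \<mu> (unrecovered ((1 / 2) ^ k) f (n k) (D k)) \<le> 2 * (1 / 2) ^ k" for k
  proof -
    have "measure \<mu> (unrecovered ((1 / 2) ^ k) f (n k) (D k)) \<le>
        measure \<mu> (unrecovered ((1 / 2) ^ k) (g k) (n k) (D k)) + n k * measure \<mu> {z \<in> space \<mu>. f z \<noteq> g k z}"
      by (rule measure_unrecovered_perturb[OF f g])
    also have "\<dots> \<le> (1 / 2) ^ k + n k * (2 * b k)"
      using rec[of k] f_g[of k] unfolding recovers_def by (intro add_mono mult_left_mono) auto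
    also have "\<dots> \<le> 2 * (1 / 2) ^ k"
      using b(2)[of k] by simp
    finally show ?thesis .
  qed
  with f D show ?thesis
    by blast
qed

end

subsection \<open>From an almost sure inverse to a conjugacy\<close>

text \<open>Keep only the points whose whole forward orbit avoids the null set where
  \<open>g\<close> fails to invert \<open>f\<close>: this domain is forward invariant, and exact
  equivariance carries the invariance over to its image.\<close>

lemma one_sidedly_conjugateI:
  assumes S: "mp_endomorphism M S" and R: "mp_endomorphism N R"
    and f: "measure_preserving M N f" and g: "g \<in> N \<rightarrow>\<^sub>M M"
    and equivariant: "\<And>z. z \<in> space M \<Longrightarrow> f (S z) = R (f z)"
    and inverse: "AE z in M. g (f z) = z"
    and eq_meas: "{l \<in> space N. f (g l) = l} \<in> sets N"
  shows "one_sidedly_conjugate M S N R"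
proof -
  have S_mp: "measure_preserving M M S"
    using S by (simp add: mp_endomorphism_def)
  have Sn [measurable]: "(S ^^ i) \<in> M \<rightarrow>\<^sub>M M" and Sn_distr: "distr M M (S ^^ i) = M" for i
    using measure_preserving_funpow[OF S_mp, of i] by (auto simp: measure_preserving_iff_distr)
  have f_meas [measurable]: "f \<in> M \<rightarrow>\<^sub>M N" and f_emeasure: "\<And>A. A \<in> sets N \<Longrightarrow> emeasure M (f -` A \<inter> space M) = emeasure N A"
    using f by (auto simp: measure_preserving_def)
  note [measurable] = g
  obtain E where E: "{z \<in> space M. \<not> g (f z) = z} \<subseteq> E" "E \<in> null_sets M"
    using inverse by (auto simp: eventually_ae_filter)
  define X where "X = {z \<in> space M. \<forall>i. (S ^^ i) z \<in> space M - E}"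
  have E_sets: "space M - E \<in> sets M"
    using E(2) by auto
  have X: "X \<in> sets M"
    unfolding X_def using E_sets by measurable
  have X_space: "z \<in> space M" and X_inv: "g (f z) = z" if "z \<in> X" for z
  proof -
    show "z \<in> space M" using that by (simp add: X_def)
    have "(S ^^ 0) z \<in> space M - E"
      using that unfolding X_def by blast
    then show "g (f z) = z"
      using E(1) by auto
  qed
  have "AE z in M. (S ^^ i) z \<in> space M - E" for i
  proof (rule AE_distrD[OF Sn])
    show "AE z in distr M M (S ^^ i). z \<in> space M - E"
      unfolding Sn_distr using AE_space[of M] AE_not_in[OF E(2)] by eventually_elim simp
  qed
  then have "AE z in M. \<forall>i. (S ^^ i) z \<in> space M - E"
    by (simp add: AE_all_countable)
  then have AE_X: "AE z in M. z \<in> X"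
    using AE_space[of M] by eventually_elim (simp add: X_def)
  have S_X: "S z \<in> X" if "z \<in> X" for z
  proof -
    have "(S ^^ i) (S z) \<in> space M - E" for i
    proof -
      have "(S ^^ Suc i) z \<in> space M - E"
        using that unfolding X_def by blast
      then show ?thesis by (simp add: funpow_swap1)
    qed
    moreover have "S z \<in> space M"
      using X_space[OF that] S_mp by (auto simp: measure_preserving_def dest: measurable_space)
    ultimately show ?thesis
      by (simp add: X_def)
  qed
  \<comment> \<open>This is the image of \<open>X\<close> under \<open>f\<close>, written so that
    its measurability follows from \<open>eq_meas\<close>.\<close>
  define Z where "Z = {l \<in> space N. f (g l) = l} \<inter> (g -` X \<inter> space N)"
  have Z: "Z \<in> sets N"
    unfolding Z_def using eq_meas measurable_sets[OF g X] by simp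
  have Z_space: "l \<in> space N" and Z_inv: "f (g l) = l" and g_Z: "g l \<in> X" if "l \<in> Z" for l
    using that by (auto simp: Z_def)
  have f_X: "f z \<in> Z" if "z \<in> X" for z
    using that X_inv[OF that] measurable_space[OF f_meas X_space[OF that]] by (simp add: Z_def)
  have R_Z: "R l \<in> Z" if "l \<in> Z" for l
    using f_X[OF S_X[OF g_Z[OF that]]] equivariant[OF X_space[OF g_Z[OF that]]] Z_inv[OF that] by simp
  have X_null: "emeasure M (space M - X) = 0"
    using AE_iff_measurable[of "space M - X" M "\<lambda>z. z \<in> X"] X AE_X by auto
  have Z_null: "emeasure N (space N - Z) = 0"
  proof -
    have "emeasure N (space N - Z) = emeasure M (f -` (space N - Z) \<inter> space M)"
      using Z by (intro f_emeasure[symmetric]) auto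
    also have "\<dots> \<le> emeasure M (space M - X)"
      using f_X X by (intro emeasure_mono) auto
    finally show ?thesis
      using X_null by simp
  qed
  have f_Z: "measure_preserving (restrict_space M X) (restrict_space N Z) f"
    unfolding measure_preserving_def
  proof (intro conjI ballI)
    show "f \<in> restrict_space M X \<rightarrow>\<^sub>M restrict_space N Z"
      by (rule measurable_restrict_space3[OF f_meas]) (use f_X in auto)
    fix A assume "A \<in> sets (restrict_space N Z)"
    then have A: "A \<in> sets N" "A \<subseteq> Z"
      using Z by (auto simp: sets_restrict_space_iff)
    have fA: "f -` A \<inter> space M \<in> sets M"
      by (rule measurable_sets[OF f_meas A(1)])
    have "emeasure (restrict_space M X) (f -` A \<inter> space (restrict_space M X)) = emeasure M (f -` A \<inter> X)"
      using X X_space by (subst emeasure_restrict_space) (auto simp: space_restrict_space Int_absorb2 subset_eq intro!: arg_cong[where f = "emeasure M"])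
    also have "f -` A \<inter> X = (f -` A \<inter> space M) \<inter> X"
      using X_space by auto
    also have "emeasure M \<dots> = emeasure M (f -` A \<inter> space M)"
      by (rule emeasure_eq_AE) (use AE_X fA X in auto)
    also have "\<dots> = emeasure N A"
      by (rule f_emeasure[OF A(1)])
    also have "\<dots> = emeasure (restrict_space N Z) A"
      using Z A by (simp add: emeasure_restrict_space)
    finally show "emeasure (restrict_space M X) (f -` A \<inter> space (restrict_space M X)) = emeasure (restrict_space N Z) A" .
  qed
  have g_X: "measure_preserving (restrict_space N Z) (restrict_space M X) g"
    unfolding measure_preserving_def
  proof (intro conjI ballI)
    show "g \<in> restrict_space N Z \<rightarrow>\<^sub>M restrict_space M X"
      by (rule measurable_restrict_space3[OF g]) (use g_Z in auto)
    fix A assume "A \<in> sets (restrict_space M X)"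
    then have A: "A \<in> sets M" "A \<subseteq> X"
      using X by (auto simp: sets_restrict_space_iff)
    have gA: "(g -` A \<inter> space N) \<inter> Z \<in> sets N"
      using measurable_sets[OF g A(1)] Z by auto
    have "emeasure (restrict_space N Z) (g -` A \<inter> space (restrict_space N Z)) = emeasure N ((g -` A \<inter> space N) \<inter> Z)"
      using Z Z_space by (subst emeasure_restrict_space) (auto simp: space_restrict_space intro!: arg_cong[where f = "emeasure N"])
    also have "\<dots> = emeasure M (f -` ((g -` A \<inter> space N) \<inter> Z) \<inter> space M)"
      by (rule f_emeasure[OF gA, symmetric])
    also have "\<dots> = emeasure M A"
    proof (rule emeasure_eq_AE)
      show "AE z in M. z \<in> f -` ((g -` A \<inter> space N) \<inter> Z) \<inter> space M \<longleftrightarrow> z \<in> A"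
        using AE_X
      proof eventually_elim
        fix z assume "z \<in> X"
        then show "z \<in> f -` ((g -` A \<inter> space N) \<inter> Z) \<inter> space M \<longleftrightarrow> z \<in> A"
          using f_X[of z] X_inv[of z] X_space[of z] Z_space[of "f z"] by auto
      qed
    qed (use measurable_sets[OF f_meas gA] A in auto)
    also have "\<dots> = emeasure (restrict_space M X) A"
      using X A by (simp add: emeasure_restrict_space)
    finally show "emeasure (restrict_space N Z) (g -` A \<inter> space (restrict_space N Z)) = emeasure (restrict_space M X) A" .
  qed
  show ?thesis
    unfolding one_sidedly_conjugate_def
    using S R X Z X_null Z_null S_X R_Z f_Z g_X X_inv Z_inv equivariant X_space
    by (intro conjI bexI[of _ X] bexI[of _ Z] exI[of _ f] exI[of _ g]) auto
qed

context ergodic_isometry begin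

lemma skew_conjugate: "one_sidedly_conjugate \<mu> S coin_measure left_shift"
proof -
  obtain f n D where f: "Measurable.pred \<mu> f" and D: "\<And>k ls. snd (D k ls) \<in> Y"
    and rec: "\<And>k. measure \<mu> (unrecovered ((1 / 2) ^ k) f (n k) (D k)) \<le> 2 * (1 / 2) ^ k"
    using exists_recovering_code by blast
  interpret F: fair_label \<mu> S "flip_label f"
    by (rule fair_label_flip_label[OF f])
  define pre where "pre k i l = map (\<lambda>j. l (i + j)) [0..<n k]" for k i and l :: "nat \<Rightarrow> nat"
  have pre: "pre k i \<in> coin_measure \<rightarrow>\<^sub>M count_space UNIV" for k i
    unfolding pre_def[abs_def] by (rule measurable_map_upt) (rule measurable_coin_component)
  define v where "v k l = snd (D k (pre k 0 l))" for k l
  have v: "v k \<in> borel_measurable coin_measure" for k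
    unfolding v_def[abs_def] by (rule measurable_compose[OF pre]) simp
  obtain y0 where y0: "y0 \<in> Y"
    using D by blast
  have Cauchy_meas: "Measurable.pred coin_measure (\<lambda>l. Cauchy (\<lambda>k. v k l))"
  proof -
    have "Measurable.pred coin_measure (\<lambda>l. dist (v i l) (v j l) < c)" for i j c
    proof -
      have "(\<lambda>l. dist (snd (D i ls)) (v j l) < c) \<in> coin_measure \<rightarrow>\<^sub>M count_space UNIV" for ls
        unfolding v_def by (rule measurable_compose[OF pre]) simp
      then show ?thesis
        unfolding v_def[of i] by (rule measurable_compose_countable[OF _ pre])
    qed
    note [measurable] = this
    show ?thesis
      unfolding metric_Cauchy_iff2 by measurable
  qed
  define w where "w k l = (if Cauchy (\<lambda>k. v k l) then v k l else y0)" for k l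
  have w: "w k \<in> borel_measurable coin_measure" for k
    unfolding w_def[abs_def] by (rule measurable_If[OF v _ Cauchy_meas[unfolded pred_def]]) simp
  define gy where "gy l = lim (\<lambda>k. w k l)" for l
  have gy: "gy l \<in> Y" "(\<lambda>k. w k l) \<longlonglongrightarrow> gy l" for l
  proof -
    have "Cauchy (\<lambda>k. w k l)"
    proof (cases "Cauchy (\<lambda>k. v k l)")
      case False
      then show ?thesis
        by (simp add: w_def LIMSEQ_imp_Cauchy[OF tendsto_const])
    qed (simp add: w_def)
    moreover have "w k l \<in> Y" for k
      using D y0 by (simp add: w_def v_def)
    ultimately obtain y where y: "y \<in> Y" "(\<lambda>k. w k l) \<longlonglongrightarrow> y"
      using completeE[OF compact_imp_complete[OF compact_Y], of "\<lambda>k. w k l"] by blast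
    then have "gy l = y"
      unfolding gy_def by (intro limI)
    with y show "gy l \<in> Y" "(\<lambda>k. w k l) \<longlonglongrightarrow> gy l"
      by auto
  qed
  have gy_meas: "gy \<in> coin_measure \<rightarrow>\<^sub>M m"
    using borel_measurable_LIMSEQ_metric[OF w gy(2)] gy(1) by (rule measurable_into_m)
  define gx where "gx l i = (if \<exists>K. \<forall>k\<ge>K. fst (D k (pre k i l)) = 1 then 1 else 0 :: nat)" for l i
  have gx_meas: "gx \<in> coin_measure \<rightarrow>\<^sub>M coin_measure"
  proof (rule measurable_into_coin)
    fix i
    have [measurable]: "Measurable.pred coin_measure (\<lambda>l. fst (D k (pre k i l)) = 1)" for k
      by (rule measurable_compose[OF pre]) simp
    show "(\<lambda>l. gx l i) \<in> coin_measure \<rightarrow>\<^sub>M count_space UNIV"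
      unfolding gx_def by measurable
  qed (simp add: gx_def)
  define g where "g l = (gx l, gy l)" for l
  have g: "g \<in> coin_measure \<rightarrow>\<^sub>M \<mu>"
    unfolding g_def[abs_def] by (rule measurable_Pair[OF gx_meas gy_meas])
  \<comment> \<open>The failure probabilities are summable, so by Borel-Cantelli almost every point
    is recovered at all late stages; by invariance the same holds at every point of its
    orbit.\<close>
  have "AE z in \<mu>. eventually (\<lambda>k. z \<in> space \<mu> - unrecovered ((1 / 2) ^ k) f (n k) (D k)) sequentially"
  proof (rule borel_cantelli_AE1)
    show "unrecovered ((1 / 2) ^ k) f (n k) (D k) \<in> sets \<mu>" for k
      by (rule sets_unrecovered[OF f])
    show "summable (\<lambda>k. measure \<mu> (unrecovered ((1 / 2) ^ k) f (n k) (D k)))"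
    proof (rule summable_comparison_test'[of _ 0])
      show "summable (\<lambda>k. 2 * (1 / 2 :: real) ^ k)"
        by (intro summable_mult summable_geometric) simp
    qed (use rec in simp)
  qed (simp add: coin_m.emeasure_eq_measure)
  then have "AE z in \<mu>. \<forall>i. eventually (\<lambda>k. (S ^^ i) z \<in> space \<mu> - unrecovered ((1 / 2) ^ k) f (n k) (D k)) sequentially"
    by (rule symbols.AE_S_funpow)
  then have inverse: "AE z in \<mu>. g (F.itinerary z) = z"
    using AE_space[of \<mu>]
  proof eventually_elim
    fix z assume ev: "\<forall>i. eventually (\<lambda>k. (S ^^ i) z \<in> space \<mu> - unrecovered ((1 / 2) ^ k) f (n k) (D k)) sequentially"
      and z: "z \<in> space \<mu>"
    have pre_labels: "pre k i (F.itinerary z) = labels f (n k) ((S ^^ i) z)" for k i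
      unfolding pre_def labels_def F.itinerary_def by (simp only: funpow_add o_apply add.commute[of i])
    have good: "eventually (\<lambda>k. fst (D k (pre k i (F.itinerary z))) = fst z i \<and>
        dist (snd ((S ^^ i) z)) (snd (D k (pre k i (F.itinerary z)))) < (1 / 2) ^ k) sequentially" for i
      using ev[rule_format, of i] by eventually_elim (auto simp: pre_labels fst_S_funpow)
    have "gx (F.itinerary z) i = fst z i" for i
    proof -
      obtain K where K: "\<And>k. K \<le> k \<Longrightarrow> fst (D k (pre k i (F.itinerary z))) = fst z i"
        using good[of i] by (auto simp: eventually_sequentially)
      have "(\<exists>K. \<forall>k\<ge>K. fst (D k (pre k i (F.itinerary z))) = 1) \<longleftrightarrow> fst z i = 1"
      proof
        assume "\<exists>K. \<forall>k\<ge>K. fst (D k (pre k i (F.itinerary z))) = 1"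
        then obtain K' where "\<And>k. K' \<le> k \<Longrightarrow> fst (D k (pre k i (F.itinerary z))) = 1"
          by blast
        from this[of "max K K'"] K[of "max K K'"] show "fst z i = 1"
          by simp
      qed (use K in auto)
      then show ?thesis
        using bit_\<mu>[OF z, of i] by (auto simp: gx_def)
    qed
    moreover have "gy (F.itinerary z) = snd z"
    proof -
      have "eventually (\<lambda>k. dist (v k (F.itinerary z)) (snd z) \<le> (1 / 2) ^ k) sequentially"
        using good[of 0] by eventually_elim (auto simp: v_def dist_commute)
      then have "(\<lambda>k. dist (v k (F.itinerary z)) (snd z)) \<longlonglongrightarrow> 0"
        by (rule tendsto_sandwich[OF _ _ tendsto_const LIMSEQ_power_zero, rotated]) auto
      then have lim: "(\<lambda>k. v k (F.itinerary z)) \<longlonglongrightarrow> snd z"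
        by (rule tendsto_dist_iff[THEN iffD2])
      then have "(\<lambda>k. w k (F.itinerary z)) \<longlonglongrightarrow> snd z"
        using LIMSEQ_imp_Cauchy[OF lim] by (simp add: w_def)
      then show ?thesis
        using gy(2) LIMSEQ_unique by blast
    qed
    ultimately show "g (F.itinerary z) = z"
      by (simp add: g_def prod_eq_iff fun_eq_iff)
  qed
  \<comment> \<open>Equality of sequences is a countable conjunction of measurable conditions on
    coordinates.\<close>
  have eq_meas: "{l \<in> space coin_measure. F.itinerary (g l) = l} \<in> sets coin_measure"
  proof -
    have comp: "(\<lambda>l. F.itinerary (g l)) \<in> coin_measure \<rightarrow>\<^sub>M coin_measure"
      by (rule measurable_compose[OF g F.measurable_itinerary])
    have [measurable]: "(\<lambda>l. F.itinerary (g l) i) \<in> coin_measure \<rightarrow>\<^sub>M count_space UNIV" for i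
      by (rule measurable_compose[OF comp measurable_coin_component])
    have "{l \<in> space coin_measure. \<forall>i. F.itinerary (g l) i = l i} \<in> sets coin_measure"
      by measurable
    then show ?thesis
      by (simp add: fun_eq_iff)
  qed
  show ?thesis
  proof (rule one_sidedly_conjugateI)
    show "mp_endomorphism \<mu> S"
      using symbols.measure_preserving_S coin_m.prob_space_axioms by (simp add: mp_endomorphism_def)
    show "F.itinerary (S z) = left_shift (F.itinerary z)" for z
      by (rule F.itinerary_S)
  qed (rule mp_endomorphism_left_shift F.measure_preserving_itinerary g inverse eq_meas)+
qed

end

theorem mainTheorem3:
  fixes Y :: "'y::metric_space set" and m :: "'y measure" and T :: "'y \<Rightarrow> 'y"
  assumes "compact Y"
    and "sets m = sets (restrict_space borel Y)"
    and "prob_space m"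
    and "isometry_on Y T"
    and "measure_preserving m m T"
    and "ergodic m T"
  shows "one_sidedly_conjugate (coin_measure \<Otimes>\<^sub>M m) (skew_id T) coin_measure left_shift"
proof -
  interpret ergodic_isometry Y m T
    using assms by unfold_locales
  show ?thesis
    by (rule skew_conjugate)
qed

end
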